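(* Let $A(x)=\sum_{i=0}^d a_ix^i\in\mathbb{Z}[x]$ be primitive of degree $d\ge1$ with $a_0\neq0$, let $m>d$, and let $p$ be a prime. Let $0=w_0<w_1<\dots<w_r=d$ be the abscissae of the vertices of the $p$-adic Newton polygon of $A$, let $\ell_k=w_k-w_{k-1}$ and $\sigma_k=(v_p(a_{w_k})-v_p(a_{w_{k-1}}))/\ell_k$ for $1\le k\le r$ (so $\sigma_1<\dots<\sigma_r$), and let $s$ be the smallest index $1\le s\le r$ with $\sigma_s\ge0$ ($s=r+1$ if there is none). Then there exists a unique $\mathbb{Z}_p$-basis of $\Lambda_m^{(p)}$ such that the $d\times m$ matrix $M=(M_{i,j})$ having these basis vectors as rows satisfies: (1) for each $1\le k\le r$ and each row index $w_{k-1}<i\le w_k$, one has $M_{i,j}=0$ for $j\le w_{k-1}$ and for $j>m-d+w_k$; thus the left $d\times d$ submatrix $(M_{i,j})_{1\le i,j\le d}$ is block upper triangular with square diagonal blocks $B_k=(M_{i,j})_{w_{k-1}<i,j\le w_k}$ of size $\ell_k$, and the right $d\times d$ submatrix $(M_{i,j})_{1\le i\le d,\ m-d<j\le m}$ is block lower triangular with square diagonal blocks $C_k=(M_{i,m-d+j})_{w_{k-1}<i,j\le w_k}$ of size $\ell_k$; (2) $B_1,\dots,B_{s-1}$ and $C_s,\dots,C_r$ are identity matrices; for $1\le k\le s-1$, $v_p(\det C_k)=-\sigma_k\ell_k(m-d)$, and for $s\le k\le r$, $v_p(\det B_k)=\sigma_k\ell_k(m-d)$; (3) for $1\le k\le s-1$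 and $w_{k-1}<j\le w_k$, $v_p(M_{j,j+t})\ge -t\sigma_k$ for all $t\ge0$ with $j+t\le m$; for $s\le k\le r$ and $w_{k-1}<j\le w_k$, $v_p(M_{j,j+m-d-t})\ge t\sigma_k$ for all $t\ge0$ with $j+m-d-t\ge1$.
   Context: $v_p$ denotes the $p$-adic valuation on $\mathbb{Q}_p$ (with $v_p(0)=\infty$) and $\mathbb{Z}_p$ the $p$-adic integers. A vector $(x_1,\dots,x_m)$ is a linear recurrence determined by $A$ if $\sum_{i=0}^d a_ix_{j+i}=0$ for all $1\le j\le m-d$. $\Lambda_m\subseteq\mathbb{Z}^m$ is the $\mathbb{Z}$-module of integral vectors that are linear recurrences determined by $A$ (it has rank $d$), and $\Lambda_m^{(p)}=\Lambda_m\otimes_{\mathbb{Z}}\mathbb{Z}_p$, which equals the $\mathbb{Z}_p$-module of vectors in $\mathbb{Z}_p^m$ that are linear recurrences determined by $A$. The $p$-adic Newton polygon of $A$ is the lower boundary of the convex hull of the points $(i,v_p(a_i))$, $0\le i\le d$ (with $a_i\ne0$). *)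

theory Defs
  imports "HOL-Computational_Algebra.Polynomial_Factorial" "HOL-Library.Extended_Real"
    "Jordan_Normal_Form.Determinant"
begin

(* p-adic integers Z_p realised as the inverse limit of Z/p^n Z:
   x n is the residue of x modulo p^n, taken in {0..p^n-1}. *)
definition padic_int :: "nat \<Rightarrow> (nat \<Rightarrow> int) \<Rightarrow> bool" where
  "padic_int p x \<longleftrightarrow>
     (\<forall>n. 0 \<le> x n \<and> x n < int p ^ n \<and> x (Suc n) mod int p ^ n = x n)"

definition pzero :: "nat \<Rightarrow> int" where "pzero = (\<lambda>n. 0)"

definition pconst :: "nat \<Rightarrow> int \<Rightarrow> nat \<Rightarrow> int" where
  "pconst p a = (\<lambda>n. a mod int p ^ n)"

definition pone :: "nat \<Rightarrow> nat \<Rightarrow> int" where "pone p = pconst p 1"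

definition pmul :: "nat \<Rightarrow> (nat \<Rightarrow> int) \<Rightarrow> (nat \<Rightarrow> int) \<Rightarrow> nat \<Rightarrow> int" where
  "pmul p x y = (\<lambda>n. (x n * y n) mod int p ^ n)"

definition psum :: "nat \<Rightarrow> ('i \<Rightarrow> nat \<Rightarrow> int) \<Rightarrow> 'i set \<Rightarrow> nat \<Rightarrow> int" where
  "psum p f I = (\<lambda>n. (\<Sum>i\<in>I. f i n) mod int p ^ n)"

definition pdet :: "nat \<Rightarrow> nat \<Rightarrow> (nat \<Rightarrow> nat \<Rightarrow> nat \<Rightarrow> int) \<Rightarrow> nat \<Rightarrow> int" where
  "pdet p k E = (\<lambda>n. det (mat k k (\<lambda>(i,j). E i j n)) mod int p ^ n)"

definition pval :: "nat \<Rightarrow> (nat \<Rightarrow> int) \<Rightarrow> ereal" where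
  "pval p x = (if \<forall>n. x n = 0 then PInfty else ereal (real (GREATEST n. x n = 0)))"

(* abscissae of the vertices of the p-adic Newton polygon of A: the indices i
   with a_i \<noteq> 0 such that (i, v_p(a_i)) is the unique minimiser of
   y - \<lambda> x over the points (j, v_p(a_j)), a_j \<noteq> 0, for some slope \<lambda> *)
definition newton_vertices :: "nat \<Rightarrow> int poly \<Rightarrow> nat set" where
  "newton_vertices p A = {i. i \<le> degree A \<and> coeff A i \<noteq> 0 \<and>
     (\<exists>c::real. \<forall>j\<le>degree A. coeff A j \<noteq> 0 \<and> j \<noteq> i \<longrightarrow>
        real (multiplicity (int p) (coeff A i)) - c * real i
        < real (multiplicity (int p) (coeff A j)) - c * real j)}"

definition rec_vec :: "nat \<Rightarrow> int poly \<Rightarrow> nat \<Rightarrow> (nat \<Rightarrow> nat \<Rightarrow> int) \<Rightarrow> bool" where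
  "rec_vec p A m x \<longleftrightarrow> (\<forall>j\<in>{1..m}. padic_int p (x j)) \<and>
     (\<forall>j\<in>{1..m - degree A}.
        psum p (\<lambda>i. pmul p (pconst p (coeff A i)) (x (j + i))) {0..degree A} = pzero)"

definition is_Zp_basis :: "nat \<Rightarrow> int poly \<Rightarrow> nat \<Rightarrow> (nat \<Rightarrow> nat \<Rightarrow> nat \<Rightarrow> int) \<Rightarrow> bool" where
  "is_Zp_basis p A m M \<longleftrightarrow>
     (\<forall>i\<in>{1..degree A}. rec_vec p A m (M i)) \<and>
     (\<forall>x. rec_vec p A m x \<longrightarrow>
        (\<exists>c. (\<forall>i\<in>{1..degree A}. padic_int p (c i)) \<and>
             (\<forall>j\<in>{1..m}. x j = psum p (\<lambda>i. pmul p (c i) (M i j)) {1..degree A}))) \<and>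
     (\<forall>c. (\<forall>i\<in>{1..degree A}. padic_int p (c i)) \<and>
          (\<forall>j\<in>{1..m}. psum p (\<lambda>i. pmul p (c i) (M i j)) {1..degree A} = pzero)
          \<longrightarrow> (\<forall>i\<in>{1..degree A}. c i = pzero))"


definition nw :: "nat \<Rightarrow> int poly \<Rightarrow> nat list" where
  "nw p A = sorted_list_of_set (newton_vertices p A)"

definition nr :: "nat \<Rightarrow> int poly \<Rightarrow> nat" where
  "nr p A = length (nw p A) - 1"

definition nlen :: "nat \<Rightarrow> int poly \<Rightarrow> nat \<Rightarrow> nat" where
  "nlen p A k = nw p A ! k - nw p A ! (k - 1)"

definition nslope :: "nat \<Rightarrow> int poly \<Rightarrow> nat \<Rightarrow> real" where
  "nslope p A k = (real (multiplicity (int p) (coeff A (nw p A ! k)))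
                   - real (multiplicity (int p) (coeff A (nw p A ! (k - 1))))) / real (nlen p A k)"

definition ns :: "nat \<Rightarrow> int poly \<Rightarrow> nat" where
  "ns p A = (if \<exists>k\<in>{1..nr p A}. nslope p A k \<ge> 0
             then LEAST k. k \<in> {1..nr p A} \<and> nslope p A k \<ge> 0 else nr p A + 1)"

end

theory Submission
  imports Defs
begin

text \<open>
  Scale the columns by a slope \<open>\<sigma>\<close> of the Newton polygon: if a recurrence has a term of minimal
  weighted valuation, the extreme such term meets, in a suitable equation, the coefficient at a
  vertex, where it strictly dominates. So minima of \<open>v(x j) + \<sigma> j\<close> occur near the left and the
  right boundary. With strictness on both sides this makes every square Toeplitz window at a vertex
  nonsingular; with the slope of the edge between consecutive vertices \<open>u < w\<close> it makes the
  recurrences supported on \<open>(u, m - d + w]\<close> freely determined by their first, or by their last,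
  \<open>w - u\<close> coordinates, with the asserted bounds on valuations. The two transition matrices between
  these normalisations are mutually inverse and satisfy opposite lower bounds on the valuations of
  their determinants, hence equality. All these rows are rational and p-integral; only the basis
  property and uniqueness involve general p-adic vectors.
\<close>

text \<open>The encoding of Z_p by compatible residues offers neither division nor an ambient field.
  Everything that divides therefore takes place over the rationals, which suffice because
  \<open>A\<close> has integer coefficients; \<open>emb\<close> transports p-integral rationals. An
  arbitrary p-adic vector is seen only through its integer approximations, for which equations
  become congruences modulo every power of p. On an edge from u to w, further points of
  \<open>A\<close> may lie on the edge line between the two vertices. Domination at w is then strict
  only over coefficients to its right, which calls for the least minimal index; at u it is strict
  only to the left, which calls for the greatest. The sign of the slope decides which normalisation
  is kept: a unit entry at column i on the left gives the bound -\<sigma>*(j-i) at column j, useful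
  to the right of i when \<sigma> < 0; a unit entry at column m-d+i gives \<sigma>*(m-d+i-j), useful
  to the left of it when \<sigma> \<ge> 0.\<close>

section \<open>Linear algebra over a field, and a gap below finitely many positive reals\<close>

text \<open>Injectivity is what valuation arguments deliver, so invertibility is derived from a
  trivial kernel and no determinant has to be computed. Indices start at 1 to match rows and columns
  of recurrences.\<close>

lemma square_system_inverse:
  fixes T :: "nat \<Rightarrow> nat \<Rightarrow> 'a::field"
  assumes ker: "\<And>y. (\<And>r. r \<in> {1..n} \<Longrightarrow> (\<Sum>c\<in>{1..n}. T r c * y c) = 0) \<Longrightarrow> \<forall>c\<in>{1..n}. y c = 0"
  obtains B where
    "\<And>i j. i \<in> {1..n} \<Longrightarrow> j \<in> {1..n} \<Longrightarrow> (\<Sum>k\<in>{1..n}. B i k * T k j) = (if i = j then 1 else 0)"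
    "\<And>i j. i \<in> {1..n} \<Longrightarrow> j \<in> {1..n} \<Longrightarrow> (\<Sum>k\<in>{1..n}. T i k * B k j) = (if i = j then 1 else 0)"
proof -
  define A where "A = mat n n (\<lambda>(i,j). T (Suc i) (Suc j))"
  have A: "A \<in> carrier_mat n n" by (simp add: A_def)
  have shift: "(\<Sum>k\<in>{1..n}. f k) = (\<Sum>k = 0..<n. f (Suc k))" for f :: "nat \<Rightarrow> 'a"
    by (rule sum.reindex_bij_witness[of _ Suc "\<lambda>k. k - 1"]) auto
  have "det A \<noteq> 0"
  proof
    assume "det A = 0"
    then obtain v where v: "v \<in> carrier_vec n" "v \<noteq> 0\<^sub>v n" "A *\<^sub>v v = 0\<^sub>v n"
      using det_0_iff_vec_prod_zero_field[OF A] by auto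
    have "\<forall>c\<in>{1..n}. v $ (c - 1) = 0"
    proof (rule ker)
      fix r assume r: "r \<in> {1..n}"
      have "(A *\<^sub>v v) $ (r - 1) = (\<Sum>k = 0..<n. A $$ (r - 1, k) * v $ k)"
        using r v(1) A by (subst index_mult_mat_vec) (auto simp: scalar_prod_def intro!: sum.cong)
      also have "\<dots> = (\<Sum>k = 0..<n. T r (Suc k) * v $ k)"
        using r by (intro sum.cong) (auto simp: A_def)
      finally show "(\<Sum>c\<in>{1..n}. T r c * v $ (c - 1)) = 0"
        using v(3) r unfolding shift by auto
    qed
    then have "v = 0\<^sub>v n"
      using v(1) by (intro eq_vecI) (auto dest!: bspec[of _ _ "Suc _"])
    with v(2) show False by simp
  qed
  from det_non_zero_imp_unit[OF A this, of "()"]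
  obtain C where C: "C \<in> carrier_mat n n" "C * A = 1\<^sub>m n"
    unfolding Units_def ring_mat_def by auto
  have AC: "A * C = 1\<^sub>m n" using mat_mult_left_right_inverse[OF C(1) A C(2)] .
  define B where "B = (\<lambda>i j. C $$ (i - 1, j - 1))"
  show thesis
  proof
    fix i j assume ij: "i \<in> {1..n}" "j \<in> {1..n}"
    have "(\<Sum>k\<in>{1..n}. B i k * T k j) = (C * A) $$ (i - 1, j - 1)"
      unfolding shift using ij A C(1) by (auto simp: B_def A_def scalar_prod_def intro!: sum.cong)
    then show "(\<Sum>k\<in>{1..n}. B i k * T k j) = (if i = j then 1 else 0)"
      using ij by (auto simp: C(2))
    have "(\<Sum>k\<in>{1..n}. T i k * B k j) = (A * C) $$ (i - 1, j - 1)"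
      unfolding shift using ij A C(1) by (auto simp: B_def A_def scalar_prod_def intro!: sum.cong)
    then show "(\<Sum>k\<in>{1..n}. T i k * B k j) = (if i = j then 1 else 0)"
      using ij by (auto simp: AC)
  qed
qed

text \<open>Supplies a perturbation of a slope that is too small to upset finitely many strict
  inequalities.\<close>

lemma finite_pos_gap:
  fixes f :: "'a \<Rightarrow> real"
  assumes "finite S" "\<And>s. s \<in> S \<Longrightarrow> f s > 0"
  obtains e where "e > 0" "\<And>s. s \<in> S \<Longrightarrow> e < f s"
proof -
  from assms have "\<exists>e>0. \<forall>s\<in>S. e < f s"
  proof (induction S rule: finite_induct)
    case (insert x S)
    then obtain e where e: "e > 0" "\<forall>s\<in>S. e < f s" by auto
    have "f x > 0" using insert by auto
    with e show ?case by (intro exI[of _ "min e (f x / 2)"]) auto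
  qed (auto intro: exI[of _ 1])
  with that show thesis by blast
qed

section \<open>The p-adic valuation on the rationals\<close>

locale padic =
  fixes p :: nat
  assumes p_prime: "prime p"
begin

abbreviation mult :: "int \<Rightarrow> nat" where "mult \<equiv> multiplicity (int p)"

definition val :: "rat \<Rightarrow> int" where
  "val q = int (mult (fst (quotient_of q))) - int (mult (snd (quotient_of q)))"

text \<open>\<open>val 0\<close> evaluates to 0 instead of infinity, hence the separate case. The
  bound is real because slopes of the Newton polygon need not be integers.\<close>

definition vge :: "rat \<Rightarrow> real \<Rightarrow> bool" where
  "vge q c \<longleftrightarrow> q = 0 \<or> c \<le> val q"

lemma p_pos: "p > 0" and p_gt1: "p > 1"
  using p_prime prime_gt_0_nat prime_gt_1_nat by auto

lemma prime_elem_p: "prime_elem (int p)"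
  using p_prime by simp

lemma mult_times: "a \<noteq> 0 \<Longrightarrow> b \<noteq> 0 \<Longrightarrow> mult (a * b) = mult a + mult b"
  by (rule prime_elem_multiplicity_mult_distrib[OF prime_elem_p])

lemma dvd_iff_mult: "x \<noteq> 0 \<Longrightarrow> int p ^ n dvd x \<longleftrightarrow> n \<le> mult x"
  by (rule power_dvd_iff_le_multiplicity) (use p_gt1 in auto)

lemma val_quot:
  assumes "a \<noteq> 0" "b \<noteq> 0"
  shows "val (rat_of_int a / rat_of_int b) = int (mult a) - int (mult b)"
proof -
  obtain x y where xy: "quotient_of (rat_of_int a / rat_of_int b) = (x, y)" by force
  have y: "y > 0" using quotient_of_denom_pos[OF xy] .
  have e: "rat_of_int a / rat_of_int b = rat_of_int x / rat_of_int y"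
    using quotient_of_div[OF xy] .
  have x: "x \<noteq> 0" using e assms by auto
  have "rat_of_int (a * y) = rat_of_int (x * b)"
    using e y assms by (simp add: field_simps)
  then have "a * y = x * b" by (simp only: of_int_eq_iff)
  then have "mult a + mult y = mult x + mult b"
    using mult_times[of a y] mult_times[of x b] x y assms by simp
  then show ?thesis by (simp add: val_def xy)
qed

lemma val_of_int: "val (rat_of_int a) = int (mult a)"
  by (simp add: val_def)

lemma rat_as_quot: obtains a b where "q = rat_of_int a / rat_of_int b" "b \<noteq> 0"
proof -
  obtain a b where ab: "quotient_of q = (a, b)" by force
  show thesis using that[OF quotient_of_div[OF ab]] quotient_of_denom_pos[OF ab] by simp
qed

lemma val_mult:
  assumes "q \<noteq> 0" "r \<noteq> 0"
  shows "val (q * r) = val q + val r"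
proof -
  obtain a b where ab: "q = rat_of_int a / rat_of_int b" "b \<noteq> 0" by (rule rat_as_quot)
  obtain c d where cd: "r = rat_of_int c / rat_of_int d" "d \<noteq> 0" by (rule rat_as_quot)
  have nz: "a \<noteq> 0" "c \<noteq> 0" using assms ab cd by auto
  have "q * r = rat_of_int (a * c) / rat_of_int (b * d)" using ab cd by simp
  then have "val (q * r) = int (mult (a * c)) - int (mult (b * d))"
    using nz ab cd val_quot[of "a * c" "b * d"] by simp
  then show ?thesis
    using nz ab cd by (simp add: val_quot mult_times)
qed

lemma val_add_ge:
  assumes "q \<noteq> 0" "r \<noteq> 0" "q + r \<noteq> 0"
  shows "min (val q) (val r) \<le> val (q + r)"
proof -
  obtain a b where ab: "q = rat_of_int a / rat_of_int b" "b \<noteq> 0" by (rule rat_as_quot)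
  obtain c d where cd: "r = rat_of_int c / rat_of_int d" "d \<noteq> 0" by (rule rat_as_quot)
  have q: "q = rat_of_int (a * d) / rat_of_int (b * d)" and r: "r = rat_of_int (b * c) / rat_of_int (b * d)"
    and s: "q + r = rat_of_int (a * d + b * c) / rat_of_int (b * d)"
    using ab cd by (auto simp: field_simps)
  have "a * d + b * c \<noteq> 0"
  proof
    assume "a * d + b * c = 0"
    then show False using s assms(3) by (simp only: of_int_0 div_0)
  qed
  then have nz: "a * d \<noteq> 0" "b * c \<noteq> 0" "b * d \<noteq> 0" "a * d + b * c \<noteq> 0"
    using assms ab cd by auto
  let ?k = "min (mult (a * d)) (mult (b * c))"
  have "int p ^ ?k dvd a * d" "int p ^ ?k dvd b * c"
    using dvd_iff_mult[OF nz(1), of ?k] dvd_iff_mult[OF nz(2), of ?k] by auto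
  then have "int p ^ ?k dvd a * d + b * c" by (rule dvd_add)
  then have "?k \<le> mult (a * d + b * c)" using nz(4) dvd_iff_mult by blast
  moreover have "val q = int (mult (a * d)) - int (mult (b * d))"
    unfolding q by (rule val_quot[OF nz(1,3)])
  moreover have "val r = int (mult (b * c)) - int (mult (b * d))"
    unfolding r by (rule val_quot[OF nz(2,3)])
  moreover have "val (q + r) = int (mult (a * d + b * c)) - int (mult (b * d))"
    unfolding s by (rule val_quot[OF nz(4,3)])
  ultimately show ?thesis by linarith
qed

lemma val_minus: "val (- q) = val q"
  by (simp add: val_def rat_uminus_code Let_def multiplicity_def split: prod.split)

lemma vge_zero [simp]: "vge 0 c"
  by (simp add: vge_def)

lemma vge_mono: "vge q c \<Longrightarrow> c' \<le> c \<Longrightarrow> vge q c'"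
  by (auto simp: vge_def)

lemma vge_mult: "vge q a \<Longrightarrow> vge r b \<Longrightarrow> vge (q * r) (a + b)"
  by (cases "q = 0 \<or> r = 0") (auto simp: vge_def val_mult)

lemma vge_add: "vge q c \<Longrightarrow> vge r c \<Longrightarrow> vge (q + r) c"
  using val_add_ge[of q r] by (cases "q = 0 \<or> r = 0 \<or> q + r = 0") (auto simp: vge_def)

lemma vge_uminus_iff [simp]: "vge (- q) c \<longleftrightarrow> vge q c"
  by (simp add: vge_def val_minus)

lemma vge_diff: "vge q c \<Longrightarrow> vge r c \<Longrightarrow> vge (q - r) c"
  using vge_add[of q c "- r"] by simp

lemma vge_commute: "vge (q - r) c \<longleftrightarrow> vge (r - q) c"
  using vge_uminus_iff[of "q - r"] by simp

lemma vge_sum: "(\<And>i. i \<in> I \<Longrightarrow> vge (f i) c) \<Longrightarrow> vge (sum f I) c"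
  by (induction I rule: infinite_finite_induct) (auto intro: vge_add)

lemma vge_of_int: "vge (rat_of_int z) (real n) \<longleftrightarrow> int p ^ n dvd z"
  by (cases "z = 0") (auto simp: vge_def val_of_int dvd_iff_mult)

lemma vge_of_int0 [simp]: "vge (rat_of_int z) 0"
  using vge_of_int[of z 0] by simp

lemma vge_one [simp]: "vge 1 0"
  using vge_of_int0[of 1] by simp

lemma vge_mult0: "vge q 0 \<Longrightarrow> vge r c \<Longrightarrow> vge (q * r) c"
  using vge_mult[of q 0 r c] by simp

lemma vge_mult0': "vge q c \<Longrightarrow> vge r 0 \<Longrightarrow> vge (q * r) c"
  using vge_mult[of q c r 0] by simp

lemma vge_prod: "(\<And>i. i \<in> I \<Longrightarrow> vge (f i) (c i)) \<Longrightarrow> vge (prod f I) (sum c I)"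
  by (induction I rule: infinite_finite_induct) (auto intro: vge_mult)

lemma vge_prod0: "(\<And>i. i \<in> I \<Longrightarrow> vge (f i) 0) \<Longrightarrow> vge (prod f I) 0"
  using vge_prod[of I f "\<lambda>_. 0"] by simp

text \<open>Solving for the term at \<open>i0\<close> expresses it by terms whose valuations, being
  integers, exceed its own by at least 1; the ultrametric inequality then contradicts its
  valuation.\<close>

lemma no_unique_dominant_term:
  assumes I: "finite I" "i0 \<in> I" and z: "sum f I = 0" and n: "f i0 \<noteq> 0"
    and dom: "\<And>i. i \<in> I \<Longrightarrow> i \<noteq> i0 \<Longrightarrow> f i = 0 \<or> val (f i0) < val (f i)"
  shows False
proof -
  have "f i0 = - sum f (I - {i0})"
    using z sum.remove[OF I(1,2), of f] by (simp add: eq_neg_iff_add_eq_0)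
  moreover have "vge (sum f (I - {i0})) (real_of_int (val (f i0)) + 1)"
    by (rule vge_sum) (use dom in \<open>force simp: vge_def\<close>)
  ultimately have "vge (f i0) (real_of_int (val (f i0)) + 1)" by (metis vge_uminus_iff)
  with n show False by (simp add: vge_def)
qed

text \<open>In each Leibniz product the contributions \<open>b * (real j - real i)\<close> cancel,
  since a permutation preserves the sum of the indices. Entry bounds that vary linearly across a
  block thus still give a sharp bound for the determinant.\<close>

lemma vge_det:
  assumes "\<And>i j. i < n \<Longrightarrow> j < n \<Longrightarrow> vge (E i j) (a + b * (real j - real i))"
  shows "vge (det (mat n n (\<lambda>(i,j). E i j))) (real n * a)"
proof -
  have "vge (signof \<pi> * (\<Prod>i = 0..<n. mat n n (\<lambda>(i,j). E i j) $$ (i, \<pi> i))) (real n * a)"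
    if \<pi>: "\<pi> permutes {0..<n}" for \<pi>
  proof -
    have lt: "\<pi> i < n" if "i < n" for i using permutes_in_image[OF \<pi>, of i] that by simp
    have "vge (\<Prod>i = 0..<n. E i (\<pi> i)) (\<Sum>i = 0..<n. a + b * (real (\<pi> i) - real i))"
      by (rule vge_prod) (use lt assms in auto)
    moreover have "(\<Sum>i = 0..<n. a + b * (real (\<pi> i) - real i)) = real n * a"
      using sum.permute[OF \<pi>, of real]
      by (simp add: sum.distrib sum_subtractf flip: sum_distrib_left)
    moreover have "(\<Prod>i = 0..<n. mat n n (\<lambda>(i,j). E i j) $$ (i, \<pi> i)) = (\<Prod>i = 0..<n. E i (\<pi> i))"
      using lt by (intro prod.cong) auto
    ultimately show ?thesis
      by (intro vge_mult0) (auto simp: sign_def)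
  qed
  then show ?thesis
    by (subst det_def'[of _ n]) (auto intro!: vge_sum)
qed

section \<open>Embedding the p-integral rationals into the p-adic integers\<close>

text \<open>\<open>res n q\<close> is arbitrary unless \<open>q\<close> is p-integral.\<close>

definition res :: "nat \<Rightarrow> rat \<Rightarrow> int" where
  "res n q = (SOME z. 0 \<le> z \<and> z < int p ^ n \<and> vge (q - of_int z) (real n))"

definition emb :: "rat \<Rightarrow> nat \<Rightarrow> int" where
  "emb q = (\<lambda>n. res n q)"

lemma res_exists:
  assumes "vge q 0"
  shows "\<exists>z. 0 \<le> z \<and> z < int p ^ n \<and> vge (q - of_int z) (real n)"
proof -
  obtain a b where ab: "quotient_of q = (a, b)" by force
  have q: "q = of_int a / of_int b" using quotient_of_div[OF ab] .
  have b: "b > 0" using quotient_of_denom_pos[OF ab] .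
  have cop: "coprime a b" using quotient_of_coprime[OF ab] .
  have "\<not> int p dvd b"
  proof
    assume d: "int p dvd b"
    then have "mult b > 0" using b dvd_iff_mult[of b 1] by simp
    moreover have "\<not> int p dvd a"
      using d cop coprime_common_divisor[OF cop, of "int p"] p_gt1 by auto
    then have "mult a = 0" by (rule not_dvd_imp_multiplicity_0)
    moreover have "a \<noteq> 0" using \<open>\<not> int p dvd a\<close> by auto
    ultimately show False using assms val_quot[of a b] b by (simp add: q vge_def)
  qed
  then have "coprime (int p ^ n) b"
    using p_prime by (simp add: prime_imp_coprime)
  then obtain u v where uv: "u * (int p ^ n) + v * b = 1"
    using bezout_int[of "int p ^ n" b] by (auto simp: coprime_iff_gcd_eq_1)
  \<comment> \<open>By the Bezout identity \<open>v\<close> inverts the denominator \<open>b\<close>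
    modulo \<open>p ^ n\<close>, so \<open>a * v\<close> represents the fraction.\<close>
  define z where "z = (a * v) mod int p ^ n"
  have mb: "mult b = 0" using \<open>\<not> int p dvd b\<close> by (rule not_dvd_imp_multiplicity_0)
  have "int p ^ n dvd a * v - z"
    unfolding z_def by (metis dvd_minus_mod)
  moreover have "a - b * z = a * u * int p ^ n + b * (a * v - z)"
    using arg_cong[OF uv, of "\<lambda>t. a * t"] by (simp add: algebra_simps)
  ultimately have "int p ^ n dvd a - b * z" by simp
  moreover have "q - of_int z = of_int (a - b * z) / of_int b"
    using b by (simp add: q field_simps)
  ultimately have "vge (q - of_int z) (real n)"
    using mb b by (cases "a - b * z = 0") (auto simp: vge_def val_quot dvd_iff_mult simp del: of_int_diff)
  moreover have "0 \<le> z" "z < int p ^ n" using p_pos by (auto simp: z_def)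
  ultimately show ?thesis by blast
qed

lemma res:
  assumes "vge q 0"
  shows "0 \<le> res n q" "res n q < int p ^ n" "vge (q - of_int (res n q)) (real n)"
  using someI_ex[OF res_exists[OF assms, of n]] by (simp_all add: res_def)

lemma eq_if_congruent:
  assumes "0 \<le> y" "y < int p ^ n" "0 \<le> z" "z < int p ^ n" "vge (of_int y - of_int z) (real n)"
  shows "y = z"
proof -
  have "int p ^ n dvd y - z" using assms(5) vge_of_int[of "y - z" n] by simp
  then have "y mod int p ^ n = z mod int p ^ n" by (simp add: mod_eq_dvd_iff)
  with assms show ?thesis by simp
qed

lemma mod_congruent: "vge (of_int (z mod int p ^ n) - of_int z) (real n)"
  using vge_of_int[of "z mod int p ^ n - z" n] by (simp add: mod_eq_dvd_iff [symmetric])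

lemma vge_trans: "vge (x - y) c \<Longrightarrow> vge (y - z) c \<Longrightarrow> vge (x - z) c"
  using vge_add[of "x - y" c "y - z"] by simp

lemma mod_eq_res:
  assumes "vge q 0" "vge (of_int z - q) (real n)"
  shows "z mod int p ^ n = res n q"
proof (rule eq_if_congruent[of _ n])
  show "vge (of_int (z mod int p ^ n) - of_int (res n q)) (real n)"
    by (meson mod_congruent vge_trans assms res(3))
qed (use res[OF assms(1)] p_pos in auto)

lemma res_zero [simp]: "res n 0 = 0"
  using mod_eq_res[of 0 0 n] by simp

lemma res_eq_0_iff: "vge q 0 \<Longrightarrow> res n q = 0 \<longleftrightarrow> vge q (real n)"
  using res(3)[of q n] mod_eq_res[of q 0 n] by auto

lemma padic_int_cong:
  assumes "padic_int p x"
  shows "vge (of_int (x (n + e)) - of_int (x n)) (real n)"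
proof (induction e)
  case (Suc e)
  have "x (Suc (n + e)) mod int p ^ (n + e) = x (n + e)"
    using assms by (simp add: padic_int_def)
  then have "vge (of_int (x (Suc (n + e))) - of_int (x (n + e))) (real (n + e))"
    using mod_congruent[of "x (Suc (n + e))" "n + e"] vge_commute by metis
  then have "vge (of_int (x (Suc (n + e))) - of_int (x (n + e))) (real n)"
    by (rule vge_mono) simp
  with Suc show ?case using vge_trans by auto
qed simp

text \<open>A whole sequence of rationals is allowed, since the coordinates of a general p-adic
  vector are only available as approximations that change with the level n.\<close>

lemma padic_int_res:
  assumes int: "\<And>n. vge (q n) 0" and comp: "\<And>n. vge (q (Suc n) - q n) (real n)"
  shows "padic_int p (\<lambda>n. res n (q n))"
  unfolding padic_int_def
proof (intro allI conjI)
  fix n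
  show "0 \<le> res n (q n)" "res n (q n) < int p ^ n" using res int by auto
  have "vge (of_int (res (Suc n) (q (Suc n))) - q (Suc n)) (real (Suc n))"
    using res(3)[OF int] vge_commute by blast
  then have "vge (of_int (res (Suc n) (q (Suc n))) - q (Suc n)) (real n)"
    by (rule vge_mono) simp
  then show "res (Suc n) (q (Suc n)) mod int p ^ n = res n (q n)"
    by (intro mod_eq_res int) (meson vge_trans comp)
qed

lemma padic_int_emb: "vge q 0 \<Longrightarrow> padic_int p (emb q)"
  unfolding emb_def by (rule padic_int_res) auto

lemma emb_zero: "emb 0 = pzero"
  by (simp add: emb_def pzero_def)

lemma emb_one: "emb 1 = pone p"
  using mod_eq_res[of 1 1] by (simp add: emb_def pone_def pconst_def)

lemma vge_mult_cong:
  assumes "vge x 0" "vge y' 0" "vge (x - x') c" "vge (y - y') c"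
  shows "vge (x * y - x' * y') c"
proof -
  have "x * y - x' * y' = x * (y - y') + (x - x') * y'" by (simp add: algebra_simps)
  then show ?thesis using vge_add[OF vge_mult0[OF assms(1,4)] vge_mult0'[OF assms(3,2)]] by simp
qed

lemma vge_prod_cong:
  assumes "\<And>i. i \<in> I \<Longrightarrow> vge (f i) 0" "\<And>i. i \<in> I \<Longrightarrow> vge (g i) 0"
    "\<And>i. i \<in> I \<Longrightarrow> vge (f i - g i) c"
  shows "vge (prod f I - prod g I) c"
  using assms
  by (induction I rule: infinite_finite_induct) (auto intro!: vge_mult_cong vge_prod0)

lemma pmul_cong:
  "vge (of_int (pmul p x y n) - of_int (x n) * of_int (y n)) (real n)"
  using mod_congruent[of "x n * y n" n] by (simp add: pmul_def)

lemma psum_cong: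
  "vge (of_int (psum p f I n) - (\<Sum>i\<in>I. of_int (f i n))) (real n)"
  using mod_congruent[of "\<Sum>i\<in>I. f i n" n] by (simp add: psum_def)

lemma psum_pmul_emb_cong:
  assumes "\<And>i. i \<in> I \<Longrightarrow> vge (g i) 0"
  shows "vge (of_int (psum p (\<lambda>i. pmul p (c i) (emb (g i))) I n) - (\<Sum>i\<in>I. of_int (c i n) * g i)) (real n)"
proof -
  have "vge ((\<Sum>i\<in>I. of_int (pmul p (c i) (emb (g i)) n)) - (\<Sum>i\<in>I. of_int (c i n) * g i)) (real n)"
    unfolding sum_subtractf [symmetric]
  proof (rule vge_sum)
    fix i assume i: "i \<in> I"
    have "vge (of_int (emb (g i) n) - g i) (real n)"
      using res(3)[OF assms[OF i]] vge_commute unfolding emb_def by blast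
    then have "vge (of_int (c i n) * of_int (emb (g i) n) - of_int (c i n) * g i) (real n)"
      using assms i by (intro vge_mult_cong) auto
    then show "vge (of_int (pmul p (c i) (emb (g i)) n) - of_int (c i n) * g i) (real n)"
      by (rule vge_trans[OF pmul_cong])
  qed
  then show ?thesis by (rule vge_trans[OF psum_cong])
qed

lemma psum_range: "0 \<le> psum p f I n" "psum p f I n < int p ^ n"
  using p_pos by (auto simp: psum_def)

lemma pval_emb_ge:
  assumes "vge q 0" "vge q c"
  shows "ereal c \<le> pval p (emb q)"
proof (cases "q = 0")
  case True
  then show ?thesis by (simp add: pval_def emb_def)
next
  case False
  define v where "v = nat (val q)"
  have v: "val q = int v" using assms(1) False by (simp add: vge_def v_def)
  \<comment> \<open>The levels with zero residue form an initial segment ending at the valuation,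
    which is what \<open>GREATEST\<close> in \<open>pval\<close> reads off.\<close>
  have iff: "emb q n = 0 \<longleftrightarrow> n \<le> v" for n
    using res_eq_0_iff[OF assms(1), of n] False v by (simp add: emb_def vge_def)
  have "(GREATEST n. emb q n = 0) = v" unfolding iff by (rule Greatest_equality) auto
  moreover have "\<not> (\<forall>n. emb q n = 0)" unfolding iff by (auto intro: exI[of _ "Suc v"])
  ultimately show ?thesis using assms(2) False v by (simp add: pval_def vge_def)
qed

lemma pval_emb:
  assumes "q \<noteq> 0" "val q \<ge> 0"
  shows "pval p (emb q) = ereal (val q)"
proof -
  define v where "v = nat (val q)"
  have v: "val q = int v" using assms by (simp add: v_def)
  have iff: "emb q n = 0 \<longleftrightarrow> n \<le> v" for n
    using res_eq_0_iff[of q n] assms v by (simp add: emb_def vge_def)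
  have "(GREATEST n. emb q n = 0) = v" unfolding iff by (rule Greatest_equality) auto
  moreover have "\<not> (\<forall>n. emb q n = 0)" unfolding iff by (auto intro: exI[of _ "Suc v"])
  ultimately show ?thesis using v by (simp add: pval_def)
qed

text \<open>At level n the residue matrix only approximates the rational one; the Leibniz expansions
  agree term by term modulo \<open>p ^ n\<close>.\<close>

lemma pdet_emb:
  assumes int: "\<And>i j. i < k \<Longrightarrow> j < k \<Longrightarrow> vge (E i j) 0"
  shows "pdet p k (\<lambda>i j. emb (E i j)) = emb (det (mat k k (\<lambda>(i,j). E i j)))"
proof
  fix n
  let ?R = "mat k k (\<lambda>(i,j). res n (E i j))" and ?Q = "mat k k (\<lambda>(i,j). E i j)"
  interpret oi: comm_ring_hom rat_of_int by standard auto
  have "vge (det (map_mat rat_of_int ?R) - det ?Q) (real n)"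
  proof -
    have "vge (signof \<pi> * (\<Prod>i = 0..<k. map_mat rat_of_int ?R $$ (i, \<pi> i))
        - signof \<pi> * (\<Prod>i = 0..<k. ?Q $$ (i, \<pi> i))) (real n)"
      if \<pi>: "\<pi> permutes {0..<k}" for \<pi>
    proof -
      have lt: "\<pi> i < k" if "i < k" for i using permutes_in_image[OF \<pi>, of i] that by simp
      have "vge ((\<Prod>i = 0..<k. map_mat rat_of_int ?R $$ (i, \<pi> i)) - (\<Prod>i = 0..<k. ?Q $$ (i, \<pi> i))) (real n)"
        using lt int res(3) vge_commute by (intro vge_prod_cong) auto
      then show ?thesis
        unfolding right_diff_distrib [symmetric] by (intro vge_mult0) (auto simp: sign_def)
    qed
    then show ?thesis
      by (subst (1 2) det_def'[of _ k]) (auto intro!: vge_sum simp flip: sum_subtractf)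
  qed
  then have "vge (of_int (det ?R) - det ?Q) (real n)" by simp
  moreover have "vge (det ?Q) 0"
    using vge_det[of k E 0 0] int by simp
  ultimately show "pdet p k (\<lambda>i j. emb (E i j)) n = emb (det ?Q) n"
    unfolding pdet_def emb_def by (intro mod_eq_res)
qed

end

section \<open>Recurrences with a window of unknowns\<close>

locale recurrence = padic +
  fixes A :: "int poly" and m :: nat
  assumes deg: "degree A \<ge> 1" and a0: "coeff A 0 \<noteq> 0" and md: "m > degree A"
begin

abbreviation N :: nat where "N \<equiv> m - degree A"

text \<open>The banded Toeplitz matrix of the recurrence, one row per equation. Without the guard,
  truncated subtraction would put the constant coefficient into every column left of the
  diagonal.\<close>

definition toep :: "nat \<Rightarrow> nat \<Rightarrow> rat" where
  "toep r j = (if r \<le> j then rat_of_int (coeff A (j - r)) else 0)"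

definition recur :: "(nat \<Rightarrow> rat) \<Rightarrow> bool" where
  "recur X \<longleftrightarrow> (\<forall>r\<in>{1..N}. (\<Sum>j\<in>{1..m}. toep r j * X j) = 0)"

text \<open>The window between, \<open>z < j\<close> and \<open>j \<le> z + N\<close>, has as many
  columns as there are equations. For \<open>z \<le> degree A\<close> it leaves \<open>z\<close>
  columns of \<open>{1..m}\<close> on the left and \<open>degree A - z\<close> on the right, as many
  as the rank of the module.\<close>

abbreviation outside :: "nat \<Rightarrow> nat \<Rightarrow> bool" where
  "outside z j \<equiv> j \<le> z \<or> z + N < j"

lemma vge_toep: "vge (toep r j) 0"
  by (simp add: toep_def)

lemma sum_toep:
  assumes "r \<in> {1..N}"
  shows "(\<Sum>i\<in>{0..degree A}. rat_of_int (coeff A i) * X (r + i)) = (\<Sum>j\<in>{1..m}. toep r j * X j)"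
proof -
  have "(\<Sum>i\<in>{0..degree A}. rat_of_int (coeff A i) * X (r + i)) = (\<Sum>j\<in>{r..r + degree A}. toep r j * X j)"
    by (rule sum.reindex_bij_witness[of _ "\<lambda>j. j - r" "\<lambda>i. r + i"]) (auto simp: toep_def)
  also have "\<dots> = (\<Sum>j\<in>{1..m}. toep r j * X j)"
    using assms md by (intro sum.mono_neutral_left) (auto simp: toep_def intro!: coeff_eq_0)
  finally show ?thesis .
qed

lemma window_sum:
  assumes "z \<le> degree A"
  shows "(\<Sum>j\<in>{1..m}. if outside z j then 0 else f j) = (\<Sum>c\<in>{1..N}. f (z + c))"
proof -
  have "(\<Sum>c\<in>{1..N}. f (z + c)) = (\<Sum>j\<in>{z+1..z+N}. f j)"
    by (rule sum.reindex_bij_witness[of _ "\<lambda>j. j - z" "\<lambda>c. z + c"]) auto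
  also have "\<dots> = (\<Sum>j\<in>{1..m}. if outside z j then 0 else f j)"
    using assms md by (intro sum.mono_neutral_cong_left) auto
  finally show ?thesis by simp
qed

lemma recurD: "recur X \<Longrightarrow> r \<in> {1..N} \<Longrightarrow> (\<Sum>j\<in>{1..m}. toep r j * X j) = 0"
  by (simp add: recur_def)

lemma recur_diff: "recur X \<Longrightarrow> recur Y \<Longrightarrow> recur (\<lambda>j. X j - Y j)"
  by (simp add: recur_def algebra_simps sum_subtractf)

lemma recur_lincomb:
  assumes "\<And>i. i \<in> I \<Longrightarrow> recur (X i)"
  shows "recur (\<lambda>j. \<Sum>i\<in>I. c i * X i j)"
proof -
  have "(\<Sum>j\<in>{1..m}. toep r j * (\<Sum>i\<in>I. c i * X i j)) = (\<Sum>i\<in>I. c i * (\<Sum>j\<in>{1..m}. toep r j * X i j))" for r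
    unfolding sum_distrib_left by (subst sum.swap) (simp add: mult_ac)
  then show ?thesis using assms by (simp add: recur_def)
qed

text \<open>
  If some weighted valuation fell below \<open>\<mu>\<close>, take the extreme index (least or greatest, according
  to the sign of \<open>\<epsilon>\<close>) where the weighted valuation is minimal: in the equation that meets this
  index in the coefficient \<open>z\<close>, that term strictly dominates.
\<close>

lemma dominance:
  assumes az: "coeff A z \<noteq> 0"
    and sup: "\<And>i. coeff A i \<noteq> 0 \<Longrightarrow> real (mult (coeff A z)) + \<sigma> * (real i - real z) \<le> real (mult (coeff A i))"
    and strict: "\<And>i. coeff A i \<noteq> 0 \<Longrightarrow> \<epsilon> * real z < \<epsilon> * real i \<Longrightarrow>
      real (mult (coeff A z)) + \<sigma> * (real i - real z) < real (mult (coeff A i))"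
    and eps: "\<epsilon> \<noteq> 0"
    and rec: "recur X"
    and out: "\<And>j. j \<in> {1..m} \<Longrightarrow> outside z j \<Longrightarrow> vge (X j) (\<mu> - \<sigma> * real j)"
    and j: "j \<in> {1..m}"
  shows "vge (X j) (\<mu> - \<sigma> * real j)"
proof (rule ccontr)
  assume neg: "\<not> vge (X j) (\<mu> - \<sigma> * real j)"
  define g where "g = (\<lambda>j. real_of_int (val (X j)) + \<sigma> * real j)"
  define S where "S = {j \<in> {1..m}. X j \<noteq> 0}"
  have S: "finite S" "j \<in> S" using neg j by (auto simp: S_def vge_def)
  define T where "T = {i \<in> S. g i = Min (g ` S)}"
  have "Min (g ` S) \<in> g ` S" using S by (intro Min_in) auto
  then have T: "finite T" "T \<noteq> {}" using S by (auto simp: T_def)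
  define l where "l = arg_min_on (\<lambda>i. \<epsilon> * real i) T"
  have l: "l \<in> T" using arg_min_if_finite(1)[OF T] by (simp add: l_def)
  have lT: "\<epsilon> * real l \<le> \<epsilon> * real i" if "i \<in> T" for i
    using arg_min_if_finite(2)[OF T, of "\<lambda>i. \<epsilon> * real i"] that by (force simp: l_def not_less)
  have lS: "l \<in> S" and gl: "g l \<le> g i" if "i \<in> S" for i
    using l S that by (auto simp: T_def)
  then have gl': "g l < g i" if "i \<in> S" "\<epsilon> * real i < \<epsilon> * real l" for i
    using that lT[of i] l by (force simp: T_def)
  have "g l < \<mu>" using gl[OF S(2)] neg by (auto simp: g_def vge_def)
  have l1: "l \<in> {1..m}" "X l \<noteq> 0" using l by (auto simp: T_def S_def)
  have "\<not> outside z l"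
    using out[OF l1(1)] l1(2) \<open>g l < \<mu>\<close> by (auto simp: vge_def g_def)
  then have r: "l - z \<in> {1..N}" and lz: "z < l" by auto
  show False
  proof (rule no_unique_dominant_term[of "{1..m}" l "\<lambda>j. toep (l - z) j * X j"])
    show "toep (l - z) l * X l \<noteq> 0" using az l1 lz by (simp add: toep_def)
    show "(\<Sum>j\<in>{1..m}. toep (l - z) j * X j) = 0" using rec r by (rule recurD)
  next
    fix i assume i: "i \<in> {1..m}" "i \<noteq> l"
    show "toep (l - z) i * X i = 0 \<or> val (toep (l - z) l * X l) < val (toep (l - z) i * X i)"
    proof (rule disjCI, rule ccontr)
      assume "\<not> val (toep (l - z) l * X l) < val (toep (l - z) i * X i)" "toep (l - z) i * X i \<noteq> 0"
      then have nz: "X i \<noteq> 0" "l - z \<le> i" "coeff A (i - (l - z)) \<noteq> 0"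
        by (auto simp: toep_def split: if_splits)
      let ?k = "i - (l - z)"
      have k: "real ?k - real z = real i - real l" using nz(2) lz by (simp add: of_nat_diff)
      have iS: "i \<in> S" using i nz by (simp add: S_def)
      have "real (mult (coeff A z)) + real_of_int (val (X l)) < real (mult (coeff A ?k)) + real_of_int (val (X i))"
      \<comment> \<open>Beyond \<open>l\<close> in the direction of \<epsilon> the coefficient lies
        strictly above the supporting line; before \<open>l\<close> the extremality of
        \<open>l\<close> makes the weighted valuation of the entry strictly larger. Either way one
        of the two inequalities being added is strict.\<close>
      proof (cases "\<epsilon> * real l < \<epsilon> * real i")
        case True
        then have "\<epsilon> * (real i - real l) > 0" by (simp add: algebra_simps)
        then have "\<epsilon> * real z < \<epsilon> * real ?k" unfolding k [symmetric] by (simp add: algebra_simps)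
        from strict[OF nz(3) this] gl[OF iS] show ?thesis
          unfolding k by (simp add: g_def algebra_simps)
      next
        case False
        with eps i(2) have "\<epsilon> * real i < \<epsilon> * real l"
          by (metis linorder_neqE mult_left_cancel of_nat_eq_iff)
        from sup[OF nz(3)] gl'[OF iS this] show ?thesis
          unfolding k by (simp add: g_def algebra_simps)
      qed
      moreover have "val (toep (l - z) l * X l) = int (mult (coeff A z)) + val (X l)"
        using l1 az lz by (simp add: toep_def val_mult val_of_int)
      moreover have "val (toep (l - z) i * X i) = int (mult (coeff A ?k)) + val (X i)"
        using nz by (simp add: toep_def val_mult val_of_int)
      ultimately show False using \<open>\<not> val _ < val _\<close> by linarith
    qed
  qed (use l1 in auto)
qed

section \<open>Windows at vertices: unique solvability over the rationals and its p-adic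
  form\<close>

lemma vertex_bounds:
  assumes "z \<in> newton_vertices p A"
  shows "z \<le> degree A" "coeff A z \<noteq> 0"
  using assms by (auto simp: newton_vertices_def)

lemma vertexD:
  assumes "z \<in> newton_vertices p A"
  obtains c where "\<And>i. coeff A i \<noteq> 0 \<Longrightarrow> i \<noteq> z \<Longrightarrow>
    real (mult (coeff A z)) + c * (real i - real z) < real (mult (coeff A i))"
proof -
  from assms obtain c where c: "\<forall>i\<le>degree A. coeff A i \<noteq> 0 \<and> i \<noteq> z \<longrightarrow>
        real (mult (coeff A z)) - c * real z < real (mult (coeff A i)) - c * real i"
    by (auto simp: newton_vertices_def)
  have "real (mult (coeff A z)) + c * (real i - real z) < real (mult (coeff A i))"
    if "coeff A i \<noteq> 0" "i \<noteq> z" for i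
  proof -
    have "i \<le> degree A" using that le_degree by blast
    then show ?thesis using c that by (force simp: algebra_simps)
  qed
  with that show thesis by blast
qed

text \<open>Zero entries outside satisfy the premise of \<open>dominance\<close> for every \<mu>.
  Taking \<mu> one above the weighted valuation at \<open>j\<close> itself makes a nonzero entry
  there impossible.\<close>

lemma window_kernel:
  assumes z: "z \<in> newton_vertices p A" and rec: "recur X"
    and out: "\<And>j. j \<in> {1..m} \<Longrightarrow> outside z j \<Longrightarrow> X j = 0" and j: "j \<in> {1..m}"
  shows "X j = 0"
proof (rule ccontr)
  assume nz: "X j \<noteq> 0"
  obtain c where lt: "\<And>i. coeff A i \<noteq> 0 \<Longrightarrow> i \<noteq> z \<Longrightarrow>
      real (mult (coeff A z)) + c * (real i - real z) < real (mult (coeff A i))"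
    using vertexD[OF z] by metis
  have "vge (X j) ((real_of_int (val (X j)) + 1 + c * real j) - c * real j)"
  proof (rule dominance[where \<epsilon> = 1])
    show "coeff A z \<noteq> 0" using vertex_bounds[OF z] by simp
    fix i assume "coeff A i \<noteq> 0"
    then show "real (mult (coeff A z)) + c * (real i - real z) \<le> real (mult (coeff A i))"
      using lt[of i] by (cases "i = z") auto
  qed (use lt rec out j in auto)
  with nz show False by (simp add: vge_def)
qed

lemma window_inverse:
  assumes z: "z \<in> newton_vertices p A"
  obtains B where
    "\<And>i j. i \<in> {1..N} \<Longrightarrow> j \<in> {1..N} \<Longrightarrow> (\<Sum>k\<in>{1..N}. B i k * toep k (z + j)) = (if i = j then 1 else 0)"
    "\<And>i j. i \<in> {1..N} \<Longrightarrow> j \<in> {1..N} \<Longrightarrow> (\<Sum>k\<in>{1..N}. toep i (z + k) * B k j) = (if i = j then 1 else 0)"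
proof (rule square_system_inverse[of N "\<lambda>r c. toep r (z + c)"])
  fix y assume y: "\<And>r. r \<in> {1..N} \<Longrightarrow> (\<Sum>c\<in>{1..N}. toep r (z + c) * y c) = 0"
  define X where "X = (\<lambda>j. if outside z j then 0 else y (j - z))"
  note zd = vertex_bounds(1)[OF z]
  have "recur X"
    unfolding recur_def
  proof
    fix r assume r: "r \<in> {1..N}"
    have "(\<Sum>j\<in>{1..m}. toep r j * X j) = (\<Sum>j\<in>{1..m}. if outside z j then 0 else toep r j * y (j - z))"
      by (intro sum.cong) (auto simp: X_def)
    also have "\<dots> = (\<Sum>c\<in>{1..N}. toep r (z + c) * y c)"
      using window_sum[OF zd, of "\<lambda>j. toep r j * y (j - z)"] by simp
    finally show "(\<Sum>j\<in>{1..m}. toep r j * X j) = 0" using y[OF r] by simp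
  qed
  then have X: "X j = 0" if "j \<in> {1..m}" for j
    by (rule window_kernel[OF z _ _ that]) (simp add: X_def)
  show "\<forall>c\<in>{1..N}. y c = 0"
  proof
    fix c assume "c \<in> {1..N}"
    then have "z + c \<in> {1..m}" "\<not> outside z (z + c)" using zd md by auto
    with X[of "z + c"] show "y c = 0" by (simp add: X_def)
  qed
qed (use that in blast)

text \<open>The prescribed outer entries are moved to the right-hand side \<open>b\<close>, and the
  invertible window matrix yields the inner ones. The values are prescribed at all outer indices,
  also beyond \<open>{1..m}\<close>, which spares range conditions later.\<close>

lemma window_solve:
  assumes z: "z \<in> newton_vertices p A"
  shows "\<exists>X. recur X \<and> (\<forall>j. outside z j \<longrightarrow> X j = f j)"
proof -
  obtain B where B:
    "\<And>i j. i \<in> {1..N} \<Longrightarrow> j \<in> {1..N} \<Longrightarrow> (\<Sum>k\<in>{1..N}. toep i (z + k) * B k j) = (if i = j then 1 else 0)"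
    using window_inverse[OF z] by metis
  note zd = vertex_bounds(1)[OF z]
  define b where "b = (\<lambda>r. \<Sum>j\<in>{1..m}. toep r j * (if outside z j then f j else 0))"
  define y where "y = (\<lambda>c. - (\<Sum>k\<in>{1..N}. B c k * b k))"
  define X where "X = (\<lambda>j. if outside z j then f j else y (j - z))"
  have "recur X"
    unfolding recur_def
  proof
    fix r assume r: "r \<in> {1..N}"
    have "(\<Sum>j\<in>{1..m}. toep r j * X j) =
        (\<Sum>j\<in>{1..m}. (if outside z j then 0 else toep r j * y (j - z)) + toep r j * (if outside z j then f j else 0))"
      by (intro sum.cong) (auto simp: X_def)
    also have "\<dots> = (\<Sum>c\<in>{1..N}. toep r (z + c) * y c) + b r"
      unfolding sum.distrib using window_sum[OF zd, of "\<lambda>j. toep r j * y (j - z)"] by (simp add: b_def)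
    also have "(\<Sum>c\<in>{1..N}. toep r (z + c) * y c) = - (\<Sum>c\<in>{1..N}. \<Sum>k\<in>{1..N}. toep r (z + c) * B c k * b k)"
      by (simp add: y_def sum_negf sum_distrib_left mult_ac)
    also have "\<dots> = - (\<Sum>k\<in>{1..N}. (\<Sum>c\<in>{1..N}. toep r (z + c) * B c k) * b k)"
      by (subst sum.swap) (simp add: sum_distrib_right)
    also have "\<dots> = - (\<Sum>k\<in>{1..N}. if r = k then b k else 0)"
      using r B by (intro arg_cong[of _ _ uminus] sum.cong) (auto)
    finally show "(\<Sum>j\<in>{1..m}. toep r j * X j) = 0" using r by simp
  qed
  then show ?thesis by (intro exI[of _ X]) (auto simp: X_def)
qed

lemma vge_lower_bound:
  assumes "finite I"
  shows "\<exists>e::nat. \<forall>k\<in>I. vge (f k) (- real e)"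
proof (intro exI ballI)
  fix k assume "k \<in> I"
  then have "nat \<bar>val (f k)\<bar> \<le> (\<Sum>k\<in>I. nat \<bar>val (f k)\<bar>)"
    using assms by (intro member_le_sum) auto
  then show "vge (f k) (- real (\<Sum>k\<in>I. nat \<bar>val (f k)\<bar>))"
    unfolding vge_def by linarith
qed

text \<open>
  The sequences \<open>y j\<close> are the p-adic approximations of the coordinates; inverting the window costs
  a bounded number \<open>e\<close> of digits, which compatibility recovers.
\<close>

lemma padic_window_kernel:
  assumes z: "z \<in> newton_vertices p A"
    and comp: "\<And>j n e. j \<in> {1..m} \<Longrightarrow> vge (y j (n + e) - y j n) (real n)"
    and rec: "\<And>r n. r \<in> {1..N} \<Longrightarrow> vge (\<Sum>j\<in>{1..m}. toep r j * y j n) (real n)"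
    and out: "\<And>j n. j \<in> {1..m} \<Longrightarrow> outside z j \<Longrightarrow> vge (y j n) (real n)"
    and j: "j \<in> {1..m}"
  shows "vge (y j n) (real n)"
proof (cases "outside z j")
  case False
  obtain B where B:
    "\<And>i j. i \<in> {1..N} \<Longrightarrow> j \<in> {1..N} \<Longrightarrow> (\<Sum>k\<in>{1..N}. B i k * toep k (z + j)) = (if i = j then 1 else 0)"
    using window_inverse[OF z] by metis
  note zd = vertex_bounds(1)[OF z]
  define i where "i = j - z"
  have i: "i \<in> {1..N}" "j = z + i" using False by (auto simp: i_def)
  obtain e :: nat where e: "\<forall>k\<in>{1..N}. vge (B i k) (- real e)"
    using vge_lower_bound[of "{1..N}" "B i"] by auto
  define l where "l = n + e"
  have eq: "vge (\<Sum>c\<in>{1..N}. toep r (z + c) * y (z + c) l) (real l)" if r: "r \<in> {1..N}" for r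
  proof -
    have "(\<Sum>c\<in>{1..N}. toep r (z + c) * y (z + c) l)
        = (\<Sum>j\<in>{1..m}. if outside z j then 0 else toep r j * y j l)"
      using window_sum[OF zd, of "\<lambda>j. toep r j * y j l"] by simp
    also have "\<dots> = (\<Sum>j\<in>{1..m}. toep r j * y j l) - (\<Sum>j\<in>{1..m}. if outside z j then toep r j * y j l else 0)"
      unfolding sum_subtractf [symmetric] by (intro sum.cong) auto
    finally show ?thesis
      using rec[OF r, of l] out by (auto intro!: vge_diff vge_sum vge_mult0 vge_toep)
  qed
  have "(\<Sum>k\<in>{1..N}. B i k * (\<Sum>c\<in>{1..N}. toep k (z + c) * y (z + c) l))
      = (\<Sum>c\<in>{1..N}. (\<Sum>k\<in>{1..N}. B i k * toep k (z + c)) * y (z + c) l)"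
    unfolding sum_distrib_left sum_distrib_right by (subst sum.swap) (simp add: mult_ac)
  also have "\<dots> = (\<Sum>c\<in>{1..N}. if i = c then y (z + c) l else 0)"
    using i B by (intro sum.cong) auto
  also have "\<dots> = y j l" using i by simp
  finally have "y j l = (\<Sum>k\<in>{1..N}. B i k * (\<Sum>c\<in>{1..N}. toep k (z + c) * y (z + c) l))" ..
  moreover have "vge \<dots> (real n)"
  proof (rule vge_sum)
    fix k assume k: "k \<in> {1..N}"
    from vge_mult[OF bspec[OF e k] eq[OF k]]
    show "vge (B i k * (\<Sum>c\<in>{1..N}. toep k (z + c) * y (z + c) l)) (real n)"
      by (simp add: l_def)
  qed
  ultimately have "vge (y j l) (real n)" by simp
  with vge_diff[OF this comp[OF j, of n e]] show ?thesis by (simp add: l_def)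
qed (use out j in blast)

section \<open>The two normalisations of a block and the valuations of its determinants\<close>

text \<open>The unit vector at column \<open>i\<close> has weighted valuation
  \<open>\<sigma> * i\<close>; this is the \<mu> that \<open>dominance\<close> carries from outside
  the window at \<open>w\<close> into it. Strictness is available to the right of \<open>w\<close>,
  hence \<epsilon> = 1.\<close>

lemma left_block_row:
  assumes w: "w \<in> newton_vertices p A" and uw: "u < i" "i \<le> w"
    and sup: "\<And>i. coeff A i \<noteq> 0 \<Longrightarrow> real (mult (coeff A w)) + \<sigma> * (real i - real w) \<le> real (mult (coeff A i))"
    and strict: "\<And>i. coeff A i \<noteq> 0 \<Longrightarrow> w < i \<Longrightarrow>
      real (mult (coeff A w)) + \<sigma> * (real i - real w) < real (mult (coeff A i))"
  shows "\<exists>X. recur X \<and> (\<forall>j. outside w j \<longrightarrow> X j = (if j = i then 1 else 0)) \<and>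
    (\<forall>j\<in>{1..m}. vge (X j) (- \<sigma> * (real j - real i)))"
proof -
  obtain X where X: "recur X" "\<And>j. outside w j \<Longrightarrow> X j = (if j = i then 1 else 0)"
    using window_solve[OF w, of "\<lambda>j. if j = i then 1 else 0"] by blast
  have "vge (X j) (\<sigma> * real i - \<sigma> * real j)" if "j \<in> {1..m}" for j
    by (rule dominance[where z = w and \<epsilon> = 1])
      (use X that sup strict vertex_bounds[OF w] in auto)
  with X show ?thesis by (intro exI[of _ X]) (auto simp: algebra_simps)
qed

text \<open>Mirror image of the left normalisation: the unit entry sits at column
  \<open>N + i\<close>, so \<mu> is \<open>\<sigma> * (N + i)\<close>, and strictness to the left of
  \<open>u\<close> calls for \<epsilon> = -1.\<close>

lemma right_block_row:
  assumes u: "u \<in> newton_vertices p A" and uw: "u < i"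
    and sup: "\<And>i. coeff A i \<noteq> 0 \<Longrightarrow> real (mult (coeff A u)) + \<sigma> * (real i - real u) \<le> real (mult (coeff A i))"
    and strict: "\<And>i. coeff A i \<noteq> 0 \<Longrightarrow> i < u \<Longrightarrow>
      real (mult (coeff A u)) + \<sigma> * (real i - real u) < real (mult (coeff A i))"
  shows "\<exists>X. recur X \<and> (\<forall>j. outside u j \<longrightarrow> X j = (if j = N + i then 1 else 0)) \<and>
    (\<forall>j\<in>{1..m}. vge (X j) (- \<sigma> * (real j - real (N + i))))"
proof -
  obtain X where X: "recur X" "\<And>j. outside u j \<Longrightarrow> X j = (if j = N + i then 1 else 0)"
    using window_solve[OF u, of "\<lambda>j. if j = N + i then 1 else 0"] by blast
  have "vge (X j) (\<sigma> * real (N + i) - \<sigma> * real j)" if "j \<in> {1..m}" for j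
    by (rule dominance[where z = u and \<epsilon> = "-1"])
      (use X that sup strict vertex_bounds[OF u] in auto)
  with X show ?thesis by (intro exI[of _ X]) (auto simp: algebra_simps)
qed

text \<open>Outside the window at \<open>u\<close>, row \<open>X i\<close> agrees with the
  combination of the rows \<open>Y\<close> whose coefficients form row \<open>i\<close> of
  \<open>C\<close>, hence everywhere. Reading columns \<open>u + 1\<close> to \<open>w\<close>,
  where \<open>X\<close> is the identity and \<open>Y\<close> is \<open>D\<close>, gives
  \<open>C * D = 1\<close>. The valuations of the two determinants add up to 0, and so do their
  lower bounds from \<open>vge_det\<close>; both bounds are therefore attained.\<close>

lemma block_dets:
  fixes X Y :: "nat \<Rightarrow> nat \<Rightarrow> rat"
  assumes u: "u \<in> newton_vertices p A" and w: "w \<in> newton_vertices p A" and uw: "u < w"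
    and X: "\<And>i. u < i \<Longrightarrow> i \<le> w \<Longrightarrow> recur (X i)"
      "\<And>i j. u < i \<Longrightarrow> i \<le> w \<Longrightarrow> outside w j \<Longrightarrow> X i j = (if j = i then 1 else 0)"
      "\<And>i j. u < i \<Longrightarrow> i \<le> w \<Longrightarrow> j \<in> {1..m} \<Longrightarrow> vge (X i j) (- \<sigma> * (real j - real i))"
    and Y: "\<And>i. u < i \<Longrightarrow> i \<le> w \<Longrightarrow> recur (Y i)"
      "\<And>i j. u < i \<Longrightarrow> i \<le> w \<Longrightarrow> outside u j \<Longrightarrow> Y i j = (if j = N + i then 1 else 0)"
      "\<And>i j. u < i \<Longrightarrow> i \<le> w \<Longrightarrow> j \<in> {1..m} \<Longrightarrow> vge (Y i j) (- \<sigma> * (real j - real (N + i)))"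
  defines "l \<equiv> w - u"
  defines "C \<equiv> mat l l (\<lambda>(i,j). X (u + 1 + i) (N + u + 1 + j))"
    and "D \<equiv> mat l l (\<lambda>(i,j). Y (u + 1 + i) (u + 1 + j))"
  shows "det C \<noteq> 0" "real_of_int (val (det C)) = - \<sigma> * real l * real N"
    "det D \<noteq> 0" "real_of_int (val (det D)) = \<sigma> * real l * real N"
proof -
  note wd = vertex_bounds(1)[OF w] and ud = vertex_bounds(1)[OF u]
  have CD: "C * D = 1\<^sub>m l"
  proof (rule eq_matI)
    fix i j assume ij: "i < dim_row (1\<^sub>m l)" "j < dim_col (1\<^sub>m l)"
    then have ij: "i < l" "j < l" by auto
    let ?i = "u + 1 + i"
    have i: "u < ?i" "?i \<le> w" using ij by (auto simp: l_def)
    \<comment> \<open>\<open>Y\<close> has unit entries in columns \<open>N + u + 1 + k\<close>, so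
      the entries of \<open>X\<close> there are the only possible coefficients; \<open>Z\<close> is
      the error, to be killed by \<open>window_kernel\<close>.\<close>
    define Z where "Z = (\<lambda>j. X ?i j - (\<Sum>k\<in>{0..<l}. X ?i (N + u + 1 + k) * Y (u + 1 + k) j))"
    have "recur Z"
      unfolding Z_def using i by (intro recur_diff recur_lincomb X(1) Y(1)) (auto simp: l_def)
    moreover have "Z j = 0" if j: "j \<in> {1..m}" "outside u j" for j
    proof -
      have "Z j = X ?i j - (\<Sum>k\<in>{0..<l}. X ?i (N + u + 1 + k) * (if j = N + u + 1 + k then 1 else 0))"
        unfolding Z_def using j(2) by (intro arg_cong2[of _ _ _ _ "(-)"] sum.cong) (auto simp: l_def Y(2))
      moreover have "X ?i j - (\<Sum>k\<in>{0..<l}. X ?i (N + u + 1 + k) * (if j = N + u + 1 + k then 1 else 0)) = 0"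
      proof (cases "j \<le> u \<or> j > N + w")
        case True
        then have "X ?i j = 0" using i uw by (subst X(2)) auto
        moreover have "(\<Sum>k\<in>{0..<l}. X ?i (N + u + 1 + k) * (if j = N + u + 1 + k then 1 else 0)) = 0"
          by (rule sum.neutral) (use True in \<open>auto simp: l_def\<close>)
        ultimately show ?thesis by simp
      next
        case False
        define k where "k = j - (N + u + 1)"
        have k: "j = N + u + 1 + k" "k < l" using False j(2) by (auto simp: k_def l_def)
        have "(\<Sum>k'\<in>{0..<l}. X ?i (N + u + 1 + k') * (if j = N + u + 1 + k' then 1 else 0))
            = (\<Sum>k'\<in>{0..<l}. if k = k' then X ?i (N + u + 1 + k') else 0)"
          using k by (intro sum.cong) auto
        then show ?thesis using k by simp
      qed
      ultimately show ?thesis by simp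
    qed
    ultimately have "Z (u + 1 + j) = 0"
      by (rule window_kernel[OF u]) (use ij wd md in \<open>auto simp: l_def\<close>)
    moreover have "X ?i (u + 1 + j) = (if i = j then 1 else 0)"
      using i ij by (subst X(2)) (auto simp: l_def)
    ultimately show "(C * D) $$ (i, j) = 1\<^sub>m l $$ (i, j)"
      using ij by (auto simp: C_def D_def Z_def scalar_prod_def)
  qed (auto simp: C_def D_def)
  have "det C * det D = 1"
    using det_mult[of C l D] CD by (simp add: C_def D_def)
  then show nz: "det C \<noteq> 0" "det D \<noteq> 0" by auto
  have v: "val (det C) + val (det D) = 0"
    using val_mult[OF nz] \<open>det C * det D = 1\<close> val_of_int[of 1] by simp
  have "vge (det C) (real l * (- \<sigma> * real N))"
    unfolding C_def
  proof (rule vge_det[where b = "- \<sigma>"])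
    fix i j assume ij: "i < l" "j < l"
    then have "N + u + 1 + j \<in> {1..m}" using wd md by (auto simp: l_def)
    from X(3)[OF _ _ this, of "u + 1 + i"] ij
    show "vge (X (u + 1 + i) (N + u + 1 + j)) (- \<sigma> * real N + - \<sigma> * (real j - real i))"
      by (simp add: l_def algebra_simps)
  qed
  moreover have "vge (det D) (real l * (\<sigma> * real N))"
    unfolding D_def
  proof (rule vge_det[where b = "- \<sigma>"])
    fix i j assume ij: "i < l" "j < l"
    then have "u + 1 + j \<in> {1..m}" using wd md by (auto simp: l_def)
    from Y(3)[OF _ _ this, of "u + 1 + i"] ij
    show "vge (Y (u + 1 + i) (u + 1 + j)) (\<sigma> * real N + - \<sigma> * (real j - real i))"
      by (simp add: l_def algebra_simps)
  qed
  moreover have "real_of_int (val (det C)) + real_of_int (val (det D)) = 0"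
    using v by linarith
  ultimately show "real_of_int (val (det C)) = - \<sigma> * real l * real N"
    "real_of_int (val (det D)) = \<sigma> * real l * real N"
    using nz by (auto simp: vge_def mult_ac)
qed

section \<open>Recurrences over the p-adic integers\<close>

lemma zero_iff_vge: "0 \<le> z \<Longrightarrow> z < int p ^ n \<Longrightarrow> z = 0 \<longleftrightarrow> vge (of_int z) (real n)"
  by (auto simp: vge_of_int dest: zdvd_imp_le)

lemma vge_iff_cong: "vge (x - y) c \<Longrightarrow> vge x c \<longleftrightarrow> vge y c"
  using vge_add[of "x - y" c y] vge_diff[of x c "x - y"] by auto

text \<open>The bridge between the encoded arithmetic and valuations: reductions modulo
  \<open>p ^ n\<close> inside sums and products are harmless at level n, so each equation becomes a
  family of rational congruences.\<close>

lemma equation_iff: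
  assumes r: "r \<in> {1..N}"
  shows "psum p (\<lambda>i. pmul p (pconst p (coeff A i)) (x (r + i))) {0..degree A} = pzero \<longleftrightarrow>
    (\<forall>n. vge (\<Sum>j\<in>{1..m}. toep r j * of_int (x j n)) (real n))"
proof -
  let ?L = "psum p (\<lambda>i. pmul p (pconst p (coeff A i)) (x (r + i))) {0..degree A}"
  have "?L n = 0 \<longleftrightarrow> vge (\<Sum>j\<in>{1..m}. toep r j * of_int (x j n)) (real n)" for n
  proof -
    have "vge (of_int (pmul p (pconst p a) y n) - of_int a * of_int (y n)) (real n)" for a y
    proof -
      have "vge (of_int (pconst p a n) * of_int (y n) - of_int a * of_int (y n)) (real n)"
        by (rule vge_mult_cong) (auto simp: pconst_def mod_congruent)
      then show ?thesis by (rule vge_trans[OF pmul_cong])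
    qed
    then have "vge ((\<Sum>i\<in>{0..degree A}. of_int (pmul p (pconst p (coeff A i)) (x (r + i)) n))
        - (\<Sum>i\<in>{0..degree A}. of_int (coeff A i) * of_int (x (r + i) n))) (real n)"
      unfolding sum_subtractf [symmetric] by (intro vge_sum)
    then have "vge (of_int (?L n) - (\<Sum>j\<in>{1..m}. toep r j * of_int (x j n))) (real n)"
      unfolding sum_toep[OF r, symmetric] by (rule vge_trans[OF psum_cong])
    then have "vge (of_int (?L n)) (real n) \<longleftrightarrow> vge (\<Sum>j\<in>{1..m}. toep r j * of_int (x j n)) (real n)"
      by (rule vge_iff_cong)
    then show ?thesis using zero_iff_vge[OF psum_range] by blast
  qed
  then show ?thesis by (auto simp: pzero_def fun_eq_iff)
qed

lemma rec_vec_iff: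
  "rec_vec p A m x \<longleftrightarrow> (\<forall>j\<in>{1..m}. padic_int p (x j)) \<and>
    (\<forall>r\<in>{1..N}. \<forall>n. vge (\<Sum>j\<in>{1..m}. toep r j * of_int (x j n)) (real n))"
  unfolding rec_vec_def by (intro conj_cong refl ball_cong equation_iff)

lemma rec_vec_emb:
  assumes "recur X" and int: "\<And>j. j \<in> {1..m} \<Longrightarrow> vge (X j) 0"
  shows "rec_vec p A m (\<lambda>j. emb (X j))"
  unfolding rec_vec_iff
proof (intro conjI ballI allI)
  fix r n assume r: "r \<in> {1..N}"
  have "vge ((\<Sum>j\<in>{1..m}. toep r j * X j) - (\<Sum>j\<in>{1..m}. toep r j * of_int (emb (X j) n))) (real n)"
    unfolding sum_subtractf [symmetric] right_diff_distrib [symmetric] emb_def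
    by (intro vge_sum vge_mult0 vge_toep res(3) int)
  then show "vge (\<Sum>j\<in>{1..m}. toep r j * of_int (emb (X j) n)) (real n)"
    using recurD[OF assms(1) r] by simp
qed (use padic_int_emb int in auto)

text \<open>At every level the difference is divisible by \<open>p ^ n\<close> throughout, and
  canonical residues that are congruent coincide.\<close>

lemma padic_window_unique:
  assumes z: "z \<in> newton_vertices p A" and x: "rec_vec p A m x" "rec_vec p A m x'"
    and out: "\<And>j. j \<in> {1..m} \<Longrightarrow> outside z j \<Longrightarrow> x j = x' j" and j: "j \<in> {1..m}"
  shows "x j = x' j"
proof
  fix n
  let ?y = "\<lambda>j n. rat_of_int (x j n) - rat_of_int (x' j n)"
  have pad: "padic_int p (x j)" "padic_int p (x' j)" if "j \<in> {1..m}" for j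
    using x that by (auto simp: rec_vec_iff)
  have "vge (?y j n) (real n)"
  proof (rule padic_window_kernel[OF z _ _ _ j])
    fix j n e assume "j \<in> {1..m}"
    from vge_diff[OF padic_int_cong[OF pad(1)[OF this], of n e] padic_int_cong[OF pad(2)[OF this], of n e]]
    show "vge (?y j (n + e) - ?y j n) (real n)" by (simp add: algebra_simps)
  next
    fix r n assume "r \<in> {1..N}"
    then show "vge (\<Sum>j\<in>{1..m}. toep r j * ?y j n) (real n)"
      using x unfolding rec_vec_iff right_diff_distrib sum_subtractf by (intro vge_diff) auto
  qed (use out in auto)
  moreover have "0 \<le> x j n" "x j n < int p ^ n" "0 \<le> x' j n" "x' j n < int p ^ n"
    using pad[OF j] by (auto simp: padic_int_def)
  ultimately show "x j n = x' j n" by (intro eq_if_congruent[of _ n])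
qed

text \<open>
  The columns outside the window at \<open>h\<close> serve as coordinates on the module of recurrences; in them
  the rows \<open>Q\<close> form a matrix that is unitriangular with respect to the ordering by \<open>rk\<close>.
\<close>

lemma basis_of_unitriangular:
  assumes h: "h \<in> newton_vertices p A"
    and rec: "\<And>i. i \<in> {1..degree A} \<Longrightarrow> recur (Q i)"
    and int: "\<And>i j. i \<in> {1..degree A} \<Longrightarrow> j \<in> {1..m} \<Longrightarrow> vge (Q i j) 0"
    and diag: "\<And>i. i \<in> {1..degree A} \<Longrightarrow> Q i (if i \<le> h then i else N + i) = 1"
    and tri: "\<And>i i'. i \<in> {1..degree A} \<Longrightarrow> i' \<in> {1..degree A} \<Longrightarrow> i' \<noteq> i \<Longrightarrow>
      Q i (if i' \<le> h then i' else N + i') \<noteq> 0 \<Longrightarrow> (rk i' :: nat) < rk i"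
  shows "is_Zp_basis p A m (\<lambda>i j. emb (Q i j))"
proof -
  define I where "I = {1..degree A}"
  have fin: "finite I" by (simp add: I_def)
  define col where "col = (\<lambda>i. if i \<le> h then i else N + i)"
  define E where "E = (\<lambda>i i'. Q i (col i'))"
  have col: "col i \<in> {1..m}" if "i \<in> I" for i using that md by (auto simp: col_def I_def)
  \<comment> \<open>Row \<open>i\<close> of \<open>E\<close> has a 1 on the diagonal and otherwise
    meets only columns of smaller rank; this form drives both inductions on \<open>rk\<close>
    below.\<close>
  have split: "(\<Sum>k\<in>I. E i k * f k) = f i + (\<Sum>k\<in>{k\<in>I. rk k < rk i}. E i k * f k)" if i: "i \<in> I" for i f
  proof -
    have "(\<Sum>k\<in>I. E i k * f k) = E i i * f i + (\<Sum>k\<in>I - {i}. E i k * f k)"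
      by (rule sum.remove[OF fin i])
    also have "(\<Sum>k\<in>I - {i}. E i k * f k) = (\<Sum>k\<in>{k\<in>I. rk k < rk i}. E i k * f k)"
      using tri[of i] i fin by (intro sum.mono_neutral_right) (auto simp: E_def col_def I_def)
    finally show ?thesis using diag i by (simp add: E_def col_def I_def)
  qed
  obtain V where VE: "\<And>i j. i \<in> I \<Longrightarrow> j \<in> I \<Longrightarrow> (\<Sum>k\<in>I. V i k * E k j) = (if i = j then 1 else 0)"
    and EV: "\<And>i j. i \<in> I \<Longrightarrow> j \<in> I \<Longrightarrow> (\<Sum>k\<in>I. E i k * V k j) = (if i = j then 1 else 0)"
  proof (rule square_system_inverse[of "degree A" E], fold I_def)
    fix y assume y: "\<And>r. r \<in> I \<Longrightarrow> (\<Sum>c\<in>I. E r c * y c) = 0"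
    have "i \<in> I \<longrightarrow> y i = 0" for i
    proof (induction "rk i" arbitrary: i rule: less_induct)
      case less
      show ?case
      proof
        assume i: "i \<in> I"
        have "(\<Sum>k\<in>{k\<in>I. rk k < rk i}. E i k * y k) = 0"
          using less by (intro sum.neutral) auto
        with y[OF i] split[OF i, of y] show "y i = 0" by simp
      qed
    qed
    then show "\<forall>c\<in>I. y c = 0" by blast
  qed (use that in blast)
  have intE: "vge (E i k) 0" if "i \<in> I" "k \<in> I" for i k
    using int col that by (auto simp: E_def I_def)
  \<comment> \<open>Forward substitution divides only by diagonal entries, which are 1, so the
    inverse stays p-integral.\<close>
  have intV: "vge (V i j) 0" if "i \<in> I" "j \<in> I" for i j
    using that
  proof (induction "rk i" arbitrary: i rule: less_induct)
    case less
    have "V i j = (if i = j then 1 else 0) - (\<Sum>k\<in>{k\<in>I. rk k < rk i}. E i k * V k j)"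
      using EV[OF less.prems] split[OF less.prems(1), of "\<lambda>k. V k j"] by (simp add: algebra_simps)
    moreover have "vge (\<Sum>k\<in>{k\<in>I. rk k < rk i}. E i k * V k j) 0"
    proof (intro vge_sum vge_mult0)
      fix k assume k: "k \<in> {k \<in> I. rk k < rk i}"
      then show "vge (E i k) 0" using intE less.prems by blast
      show "vge (V k j) 0" using less k by blast
    qed
    ultimately show ?case using vge_diff by simp
  qed
  show ?thesis
    unfolding is_Zp_basis_def I_def [symmetric]
  proof (intro conjI ballI allI impI)
    fix i assume "i \<in> I"
    then show "rec_vec p A m (\<lambda>j. emb (Q i j))"
      using rec int by (intro rec_vec_emb) (auto simp: I_def)
  next
    fix x assume x: "rec_vec p A m x"
    then have pad: "padic_int p (x j)" if "j \<in> {1..m}" for j using that by (simp add: rec_vec_iff)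
    \<comment> \<open>Level-n coordinates of \<open>x\<close> in the basis: its entries in the outer
      columns times the inverse of \<open>E\<close>. They are rationals, and \<open>c\<close>
      collects their residues.\<close>
    define g where "g = (\<lambda>i n. \<Sum>s\<in>I. of_int (x (col s) n) * V s i)"
    define c where "c = (\<lambda>i n. res n (g i n))"
    have gint: "vge (g i n) 0" if "i \<in> I" for i n
      unfolding g_def using that intV by (intro vge_sum vge_mult0) auto
    have gcomp: "vge (g i (n + e) - g i n) (real n)" if "i \<in> I" for i n e
      unfolding g_def sum_subtractf [symmetric] left_diff_distrib [symmetric]
      using that intV pad col by (intro vge_sum vge_mult0' padic_int_cong) auto
    have c: "padic_int p (c i)" if "i \<in> I" for i
      unfolding c_def using gcomp[OF that, of _ 1] gint[OF that] by (intro padic_int_res) auto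
    \<comment> \<open>The error of the expansion at level n. By the choice of \<open>g\<close> it
      vanishes in the outer columns, so the kernel property of the window at \<open>h\<close> makes
      it divisible by \<open>p ^ n\<close> everywhere.\<close>
    define y where "y = (\<lambda>j n. of_int (x j n) - (\<Sum>i\<in>I. g i n * Q i j))"
    have y: "vge (y j n) (real n)" if j: "j \<in> {1..m}" for j n
    proof (rule padic_window_kernel[OF h _ _ _ j])
      fix j n e assume j: "j \<in> {1..m}"
      have "y j (n + e) - y j n = (of_int (x j (n + e)) - of_int (x j n))
          - (\<Sum>i\<in>I. (g i (n + e) - g i n) * Q i j)"
        by (simp add: y_def left_diff_distrib sum_subtractf)
      moreover have "vge (\<Sum>i\<in>I. (g i (n + e) - g i n) * Q i j) (real n)"
        using gcomp int j by (intro vge_sum vge_mult0') (auto simp: I_def)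
      ultimately show "vge (y j (n + e) - y j n) (real n)"
        using vge_diff[OF padic_int_cong[OF pad[OF j], of n e]] by simp
    next
      fix r n assume r: "r \<in> {1..N}"
      have "recur (\<lambda>j. \<Sum>i\<in>I. g i n * Q i j)"
        using rec by (intro recur_lincomb) (auto simp: I_def)
      then have "(\<Sum>j\<in>{1..m}. toep r j * y j n) = (\<Sum>j\<in>{1..m}. toep r j * of_int (x j n))"
        using recurD r by (simp add: y_def right_diff_distrib sum_subtractf)
      then show "vge (\<Sum>j\<in>{1..m}. toep r j * y j n) (real n)"
        using x r by (simp add: rec_vec_iff)
    next
      fix j n assume j: "j \<in> {1..m}" "outside h j"
      define s where "s = (if j \<le> h then j else j - N)"
      have s: "s \<in> I" "j = col s"
        using j vertex_bounds(1)[OF h] by (auto simp: s_def I_def col_def)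
      have "(\<Sum>i\<in>I. g i n * Q i j) = (\<Sum>t\<in>I. of_int (x (col t) n) * (\<Sum>i\<in>I. V t i * E i s))"
        unfolding g_def s(2) E_def sum_distrib_left sum_distrib_right
        by (subst sum.swap) (simp add: mult_ac)
      also have "\<dots> = (\<Sum>t\<in>I. if t = s then of_int (x (col t) n) else 0)"
        using VE s(1) by (intro sum.cong) auto
      also have "\<dots> = of_int (x j n)" using s fin by simp
      finally show "vge (y j n) (real n)" by (simp add: y_def)
    qed
    show "\<exists>c. (\<forall>i\<in>I. padic_int p (c i)) \<and>
        (\<forall>j\<in>{1..m}. x j = psum p (\<lambda>i. pmul p (c i) (emb (Q i j))) I)"
    proof (intro exI[of _ c] conjI ballI ext)
      fix j n assume j: "j \<in> {1..m}"
      let ?S = "psum p (\<lambda>i. pmul p (c i) (emb (Q i j))) I n"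
      have "vge (of_int ?S - (\<Sum>i\<in>I. of_int (c i n) * Q i j)) (real n)"
        using int j by (intro psum_pmul_emb_cong) (auto simp: I_def)
      moreover have "vge ((\<Sum>i\<in>I. of_int (c i n) * Q i j) - (\<Sum>i\<in>I. g i n * Q i j)) (real n)"
        unfolding sum_subtractf [symmetric] left_diff_distrib [symmetric]
      proof (intro vge_sum vge_mult0')
        fix i assume i: "i \<in> I"
        show "vge (of_int (c i n) - g i n) (real n)"
          unfolding c_def by (rule vge_commute[THEN iffD1, OF res(3)[OF gint[OF i]]])
        show "vge (Q i j) 0" using int i j by (simp add: I_def)
      qed
      moreover have "vge ((\<Sum>i\<in>I. g i n * Q i j) - of_int (x j n)) (real n)"
        by (rule vge_commute[THEN iffD1, OF y[OF j, of n, unfolded y_def]])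
      ultimately have "vge (of_int ?S - of_int (x j n)) (real n)"
        by (rule vge_trans[OF vge_trans])
      moreover have "0 \<le> x j n" "x j n < int p ^ n" using pad[OF j] by (auto simp: padic_int_def)
      ultimately show "x j n = ?S"
        using eq_if_congruent[OF psum_range] by metis
    qed (use c in blast)
  next
    fix c t assume c: "(\<forall>i\<in>I. padic_int p (c i)) \<and>
      (\<forall>j\<in>{1..m}. psum p (\<lambda>i. pmul p (c i) (emb (Q i j))) I = pzero)" and t: "t \<in> I"
    show "c t = pzero"
    proof
      fix n
      have z: "vge (\<Sum>i\<in>I. of_int (c i n) * E i s) (real n)" if s: "s \<in> I" for s
      proof -
        have "psum p (\<lambda>i. pmul p (c i) (emb (Q i (col s)))) I n = 0"
          using c col[OF s] by (simp add: pzero_def)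
        then show ?thesis
          using psum_pmul_emb_cong[of I "\<lambda>i. Q i (col s)" c n] int col[OF s]
          by (simp add: E_def I_def)
      qed
      \<comment> \<open>Multiplying the vanishing outer entries by the p-integral inverse recovers
        each coefficient without loss of digits.\<close>
      have "(\<Sum>s\<in>I. (\<Sum>i\<in>I. of_int (c i n) * E i s) * V s t) = (\<Sum>i\<in>I. of_int (c i n) * (\<Sum>s\<in>I. E i s * V s t))"
        unfolding sum_distrib_left sum_distrib_right by (subst sum.swap) (simp add: mult_ac)
      also have "\<dots> = (\<Sum>i\<in>I. if i = t then of_int (c i n) else 0)"
        using EV t by (intro sum.cong) auto
      also have "\<dots> = of_int (c t n)" using t fin by simp
      finally have "of_int (c t n) = (\<Sum>s\<in>I. (\<Sum>i\<in>I. of_int (c i n) * E i s) * V s t)" ..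
      moreover have "vge \<dots> (real n)"
        by (rule vge_sum, rule vge_mult0'[OF z intV]) (use t in auto)
      ultimately have "vge (of_int (c t n)) (real n)" by simp
      moreover have "0 \<le> c t n" "c t n < int p ^ n" using c t by (auto simp: padic_int_def)
      ultimately show "c t n = pzero n" using zero_iff_vge by (simp add: pzero_def)
    qed
  qed
qed

section \<open>The Newton polygon\<close>

lemma finite_vertices: "finite (newton_vertices p A)"
  by (rule finite_subset[of _ "{..degree A}"]) (auto simp: newton_vertices_def)

text \<open>The slope \<open>- (v + 1)\<close>, with v the valuation of the constant coefficient,
  raises every later point by at least v + 1, more than v itself.\<close>

lemma zero_vertex: "0 \<in> newton_vertices p A"
proof -
  let ?v = "real (mult (coeff A 0))"
  have "?v - - (?v + 1) * real 0 < real (mult (coeff A j)) - - (?v + 1) * real j" if "j \<noteq> 0" for j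
  proof -
    have "(?v + 1) * 1 \<le> (?v + 1) * real j" using that by (intro mult_left_mono) auto
    then show ?thesis by (simp add: algebra_simps)
  qed
  then show ?thesis using a0 unfolding newton_vertices_def by blast
qed

text \<open>Here the slope \<open>v + 1\<close> does the same from the right, with v the valuation
  of the leading coefficient.\<close>

lemma degree_vertex: "degree A \<in> newton_vertices p A"
proof -
  let ?v = "real (mult (coeff A (degree A)))"
  have "?v - (?v + 1) * real (degree A) < real (mult (coeff A j)) - (?v + 1) * real j"
    if "j \<le> degree A" "j \<noteq> degree A" for j
  proof -
    have "real j + 1 \<le> real (degree A)" using that by linarith
    then have "(?v + 1) * (real j + 1) \<le> (?v + 1) * real (degree A)" by (intro mult_left_mono) auto
    then show ?thesis by (simp add: algebra_simps)
  qed
  moreover have "coeff A (degree A) \<noteq> 0" using deg by auto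
  ultimately show ?thesis unfolding newton_vertices_def by blast
qed

text \<open>A slope exposing \<open>u\<close> is smaller than \<sigma>, because \<open>w\<close>
  lies strictly above its line; a point left of \<open>u\<close> on or below the edge line would
  force it to be larger. The argument at \<open>w\<close> is symmetric.\<close>

lemma edge_above_outside:
  assumes u: "u \<in> newton_vertices p A" and w: "w \<in> newton_vertices p A" and uw: "u < w"
    and slope: "\<sigma> * (real w - real u) = real (mult (coeff A w)) - real (mult (coeff A u))"
    and i: "coeff A i \<noteq> 0" "i < u \<or> w < i"
  shows "real (mult (coeff A w)) + \<sigma> * (real i - real w) < real (mult (coeff A i))"
proof (rule ccontr)
  assume neg: "\<not> ?thesis"
  obtain c where c: "\<And>i. coeff A i \<noteq> 0 \<Longrightarrow> i \<noteq> u \<Longrightarrow>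
      real (mult (coeff A u)) + c * (real i - real u) < real (mult (coeff A i))"
    using vertexD[OF u] by metis
  obtain c' where c': "\<And>i. coeff A i \<noteq> 0 \<Longrightarrow> i \<noteq> w \<Longrightarrow>
      real (mult (coeff A w)) + c' * (real i - real w) < real (mult (coeff A i))"
    using vertexD[OF w] by metis
  note nz = vertex_bounds(2)[OF u] vertex_bounds(2)[OF w]
  from i(2) show False
  proof
    assume iu: "i < u"
    have "(c - \<sigma>) * (real w - real u) < 0" using c[OF nz(2)] uw slope by (simp add: algebra_simps)
    then have "c < \<sigma>" using uw by (simp add: mult_less_0_iff)
    moreover have "(c - \<sigma>) * (real i - real u) < 0"
      using c[OF i(1)] iu slope neg by (simp add: algebra_simps)
    then have "c > \<sigma>" using iu by (simp add: mult_less_0_iff)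
    ultimately show False by simp
  next
    assume iw: "w < i"
    have "(c' - \<sigma>) * (real u - real w) < 0" using c'[OF nz(1)] uw slope by (simp add: algebra_simps)
    then have "c' > \<sigma>" using uw by (simp add: mult_less_0_iff)
    moreover have "(c' - \<sigma>) * (real i - real w) < 0"
      using c'[OF i(1)] iw neg by (simp add: algebra_simps)
    then have "c' < \<sigma>" using iw by (simp add: mult_less_0_iff)
    ultimately show False by simp
  qed
qed

text \<open>
  A point below the edge would produce a vertex strictly between \<open>u\<close> and \<open>w\<close>: the leftmost of the
  points lowest with respect to the slope \<open>\<sigma>\<close>, exposed by a slightly smaller slope.
\<close>

lemma edge_above:
  assumes u: "u \<in> newton_vertices p A" and w: "w \<in> newton_vertices p A" and uw: "u < w"
    and adj: "\<And>z. z \<in> newton_vertices p A \<Longrightarrow> \<not> (u < z \<and> z < w)"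
    and slope: "\<sigma> * (real w - real u) = real (mult (coeff A w)) - real (mult (coeff A u))"
    and i: "coeff A i \<noteq> 0"
  shows "real (mult (coeff A w)) + \<sigma> * (real i - real w) \<le> real (mult (coeff A i))"
proof (rule ccontr)
  assume neg: "\<not> ?thesis"
  define g where "g = (\<lambda>i. real (mult (coeff A i)) - \<sigma> * real i)"
  define S where "S = {i. i \<le> degree A \<and> coeff A i \<noteq> 0}"
  have S: "finite S" "i \<in> S" using i le_degree by (auto simp: S_def)
  define b where "b = Min (g ` S)"
  have b: "b \<in> g ` S" "\<And>j. j \<in> S \<Longrightarrow> b \<le> g j" using S by (auto simp: b_def intro!: Min_in)
  define k where "k = (LEAST k. k \<in> S \<and> g k = b)"
  have k: "k \<in> S \<and> g k = b" unfolding k_def by (rule LeastI_ex) (use b in auto)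
  have kl: "b < g j" if "j \<in> S" "j < k" for j
    using not_less_Least[of j "\<lambda>k. k \<in> S \<and> g k = b"] that b(2)[of j] by (fastforce simp: k_def)
  have "b < g w" using b(2)[OF S(2)] neg by (simp add: g_def algebra_simps)
  then have kw: "\<not> real (mult (coeff A w)) + \<sigma> * (real k - real w) \<le> real (mult (coeff A k))"
    using k by (simp add: g_def algebra_simps)
  have "\<not> (k < u \<or> w < k)"
    using edge_above_outside[OF u w uw slope, of k] kw k by (auto simp: S_def)
  moreover have "g u = g w" using slope by (simp add: g_def algebra_simps)
  then have "k \<noteq> u" "k \<noteq> w" using \<open>b < g w\<close> k by auto
  ultimately have between: "u < k \<and> k < w" by auto
  \<comment> \<open>Lowering the slope to \<open>\<sigma> - e\<close> favours points left of
    \<open>k\<close> by \<open>e * (k - j)\<close>, at most \<open>e * k\<close>; dividing the gap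
    by \<open>k\<close> keeps this below \<open>g j - b\<close>. Points right of \<open>k\<close>
    only move up.\<close>
  obtain e where e: "e > 0" "\<And>j. j \<in> {j\<in>S. j < k} \<Longrightarrow> e < (g j - b) / real k"
    by (rule finite_pos_gap[of "{j\<in>S. j < k}" "\<lambda>j. (g j - b) / real k"])
      (use S kl between in auto)
  have "k \<in> newton_vertices p A"
    unfolding newton_vertices_def
  proof (intro CollectI conjI exI[of _ "\<sigma> - e"] allI impI)
    fix j assume j: "j \<le> degree A" "coeff A j \<noteq> 0 \<and> j \<noteq> k"
    then have jS: "j \<in> S" by (simp add: S_def)
    have "b + e * real k < g j + e * real j"
    proof (cases "j < k")
      case True
      then have "e * real k < g j - b" using e(2)[of j] jS between by (simp add: field_simps)
      moreover have "e * real j \<ge> 0" using e by simp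
      ultimately show ?thesis by linarith
    next
      case False
      then have "e * real k < e * real j" using e j by simp
      then show ?thesis using b(2)[OF jS] by linarith
    qed
    then show "real (mult (coeff A k)) - (\<sigma> - e) * real k < real (mult (coeff A j)) - (\<sigma> - e) * real j"
      using k by (simp add: g_def algebra_simps)
  qed (use k in \<open>auto simp: S_def\<close>)
  with adj between show False by blast
qed

section \<open>Numbering of the vertices, slopes, and the blocks of row indices\<close>

abbreviation nv :: "nat \<Rightarrow> nat" where "nv k \<equiv> nw p A ! k"

lemma set_nw: "set (nw p A) = newton_vertices p A"
  by (simp add: nw_def finite_vertices)

lemma length_nw: "length (nw p A) = Suc (nr p A)" "nr p A \<ge> 1"
proof -
  have "card {0, degree A} \<le> card (newton_vertices p A)"
    by (rule card_mono) (use finite_vertices zero_vertex degree_vertex in auto)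
  then have "2 \<le> length (nw p A)" using deg by (simp add: nw_def)
  then show "length (nw p A) = Suc (nr p A)" "nr p A \<ge> 1" by (auto simp: nr_def)
qed

lemma nv_vertex: "k \<le> nr p A \<Longrightarrow> nv k \<in> newton_vertices p A"
  using nth_mem[of k "nw p A"] length_nw set_nw by auto

lemma nv_less_iff: "k \<le> nr p A \<Longrightarrow> l \<le> nr p A \<Longrightarrow> nv k < nv l \<longleftrightarrow> k < l"
proof -
  have s: "sorted_wrt (<) (nw p A)" by (simp add: nw_def)
  assume "k \<le> nr p A" "l \<le> nr p A"
  then show ?thesis
    using sorted_wrt_nth_less[OF s, of k l] sorted_wrt_nth_less[OF s, of l k] length_nw(1)
    by (cases k l rule: linorder_cases) auto
qed

lemma nv_le_iff: "k \<le> nr p A \<Longrightarrow> l \<le> nr p A \<Longrightarrow> nv k \<le> nv l \<longleftrightarrow> k \<le> l"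
  using nv_less_iff[of l k] by auto

lemma vertex_is_nv:
  assumes "z \<in> newton_vertices p A"
  obtains k where "k \<le> nr p A" "z = nv k"
  using assms set_nw length_nw(1) by (metis in_set_conv_nth less_Suc_eq_le)

lemma nv_0: "nv 0 = 0"
proof -
  obtain k where k: "k \<le> nr p A" "0 = nv k" using vertex_is_nv[OF zero_vertex] .
  then show ?thesis using nv_le_iff[of 0 k] by simp
qed

lemma nv_nr: "nv (nr p A) = degree A"
proof -
  obtain k where k: "k \<le> nr p A" "degree A = nv k" using vertex_is_nv[OF degree_vertex] .
  then show ?thesis
    using nv_le_iff[of k "nr p A"] vertex_bounds(1)[OF nv_vertex[of "nr p A"]] by simp
qed

lemma nv_adjacent:
  assumes k: "k \<in> {1..nr p A}" and z: "z \<in> newton_vertices p A"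
  shows "\<not> (nv (k - 1) < z \<and> z < nv k)"
proof -
  obtain l where "l \<le> nr p A" "z = nv l" using vertex_is_nv[OF z] .
  moreover have "k - 1 \<le> nr p A" "k \<le> nr p A" using k by auto
  ultimately show ?thesis using nv_less_iff[of "k - 1" l] nv_less_iff[of l k] by auto
qed

lemma nv_step: "k \<in> {1..nr p A} \<Longrightarrow> nv (k - 1) < nv k"
  by (subst nv_less_iff) auto

lemma nslope_eq:
  assumes "k \<in> {1..nr p A}"
  shows "nslope p A k * (real (nv k) - real (nv (k - 1)))
    = real (mult (coeff A (nv k))) - real (mult (coeff A (nv (k - 1))))"
  using nv_step[OF assms] by (simp add: nslope_def nlen_def of_nat_diff)

text \<open>The next vertex lies strictly above the line through edge \<open>k\<close>, so the edge
  leading to it is steeper.\<close>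

lemma nslope_Suc:
  assumes k: "k \<in> {1..nr p A}" "Suc k \<le> nr p A"
  shows "nslope p A k < nslope p A (Suc k)"
proof -
  have lt: "nv k < nv (Suc k)" using nv_less_iff[of k "Suc k"] k by auto
  have "real (mult (coeff A (nv k))) + nslope p A k * (real (nv (Suc k)) - real (nv k))
      < real (mult (coeff A (nv (Suc k))))"
    by (rule edge_above_outside[OF nv_vertex nv_vertex nv_step[OF k(1)] nslope_eq[OF k(1)]])
      (use k lt vertex_bounds(2)[OF nv_vertex[OF k(2)]] in auto)
  also have "real (mult (coeff A (nv (Suc k)))) =
      real (mult (coeff A (nv k))) + nslope p A (Suc k) * (real (nv (Suc k)) - real (nv k))"
    using nslope_eq[of "Suc k"] k by simp
  finally have "nslope p A k * (real (nv (Suc k)) - real (nv k))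
      < nslope p A (Suc k) * (real (nv (Suc k)) - real (nv k))" by simp
  then show ?thesis using lt by (simp add: mult_less_cancel_right)
qed

lemma nslope_mono:
  assumes "k \<in> {1..nr p A}" "k \<le> l" "l \<le> nr p A"
  shows "nslope p A k \<le> nslope p A l"
  using assms(2,3,1)
proof (induction l rule: dec_induct)
  case (step l)
  then show ?case using nslope_Suc[of l] by fastforce
qed simp

lemma ns_range: "ns p A \<in> {1..Suc (nr p A)}"
  and nslope_before: "k \<in> {1..nr p A} \<Longrightarrow> k < ns p A \<Longrightarrow> nslope p A k < 0"
  and nslope_after: "k \<in> {1..nr p A} \<Longrightarrow> ns p A \<le> k \<Longrightarrow> nslope p A k \<ge> 0"
proof -
  let ?P = "\<lambda>k. k \<in> {1..nr p A} \<and> nslope p A k \<ge> 0"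
  have "ns p A \<in> {1..Suc (nr p A)} \<and> (\<forall>k\<in>{1..nr p A}. k < ns p A \<longrightarrow> nslope p A k < 0) \<and>
    (\<forall>k\<in>{1..nr p A}. ns p A \<le> k \<longrightarrow> nslope p A k \<ge> 0)"
  proof (cases "\<exists>k\<in>{1..nr p A}. nslope p A k \<ge> 0")
    case True
    then have ns: "ns p A = (LEAST k. ?P k)" by (simp add: ns_def)
    have P: "?P (ns p A)" unfolding ns by (rule LeastI_ex) (use True in auto)
    have "nslope p A k < 0" if "k \<in> {1..nr p A}" "k < ns p A" for k
      using not_less_Least[of k ?P] that by (simp add: ns)
    moreover have "nslope p A k \<ge> 0" if "k \<in> {1..nr p A}" "ns p A \<le> k" for k
      using nslope_mono[of "ns p A" k] that P by simp
    ultimately show ?thesis using P by auto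
  next
    case False
    then have "ns p A = nr p A + 1" unfolding ns_def by simp
    with False show ?thesis by force
  qed
  then show "ns p A \<in> {1..Suc (nr p A)}"
    "k \<in> {1..nr p A} \<Longrightarrow> k < ns p A \<Longrightarrow> nslope p A k < 0"
    "k \<in> {1..nr p A} \<Longrightarrow> ns p A \<le> k \<Longrightarrow> nslope p A k \<ge> 0" by blast+
qed

text \<open>For a row index in \<open>{1..degree A}\<close> this is the number of the edge whose
  half-open interval of abscissae contains it.\<close>

definition blk :: "nat \<Rightarrow> nat" where "blk i = (LEAST k. i \<le> nv k)"

lemma blk:
  assumes "i \<in> {1..degree A}"
  shows "blk i \<in> {1..nr p A}" "nv (blk i - 1) < i" "i \<le> nv (blk i)"
proof -
  have ex: "i \<le> nv (nr p A)" using assms nv_nr by simp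
  show le: "i \<le> nv (blk i)" unfolding blk_def by (rule LeastI[of _ "nr p A"]) (rule ex)
  have "blk i \<le> nr p A" unfolding blk_def by (rule Least_le) (rule ex)
  moreover have "blk i \<noteq> 0"
  proof
    assume "blk i = 0"
    with le nv_0 assms show False by simp
  qed
  ultimately show "blk i \<in> {1..nr p A}" by simp
  show "nv (blk i - 1) < i"
    using not_less_Least[of "blk i - 1" "\<lambda>k. i \<le> nv k"] \<open>blk i \<noteq> 0\<close>
    by (auto simp: blk_def [symmetric])
qed

lemma blk_eqI:
  assumes k: "k \<in> {1..nr p A}" and i: "nv (k - 1) < i" "i \<le> nv k"
  shows "i \<in> {1..degree A}" "blk i = k"
proof -
  show d: "i \<in> {1..degree A}"
    using i vertex_bounds(1)[OF nv_vertex[of k]] k by auto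
  note b = blk[OF d]
  have "nv (k - 1) < nv (blk i)" "nv (blk i - 1) < nv k" using i b by auto
  moreover have "k - 1 \<le> nr p A" "k \<le> nr p A" "blk i - 1 \<le> nr p A" "blk i \<le> nr p A"
    using k b(1) by auto
  ultimately have "k - 1 < blk i" "blk i - 1 < k" by (simp_all only: nv_less_iff)
  then show "blk i = k" by linarith
qed

text \<open>One edge line written from both ends: the form at \<open>nv k\<close> feeds the left
  normalisation, the form at \<open>nv (k - 1)\<close> the right one.\<close>

lemma edge_bounds:
  assumes k: "k \<in> {1..nr p A}" and i: "coeff A i \<noteq> 0"
  shows "real (mult (coeff A (nv k))) + nslope p A k * (real i - real (nv k)) \<le> real (mult (coeff A i))"
    "i < nv (k - 1) \<or> nv k < i \<Longrightarrow>
      real (mult (coeff A (nv k))) + nslope p A k * (real i - real (nv k)) < real (mult (coeff A i))"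
    "real (mult (coeff A (nv (k - 1)))) + nslope p A k * (real i - real (nv (k - 1))) \<le> real (mult (coeff A i))"
    "i < nv (k - 1) \<or> nv k < i \<Longrightarrow>
      real (mult (coeff A (nv (k - 1)))) + nslope p A k * (real i - real (nv (k - 1))) < real (mult (coeff A i))"
proof -
  have v: "nv (k - 1) \<in> newton_vertices p A" "nv k \<in> newton_vertices p A"
    using k by (auto intro!: nv_vertex)
  note lt = nv_step[OF k] and sl = nslope_eq[OF k]
  have eq: "real (mult (coeff A (nv (k - 1)))) + nslope p A k * (real i - real (nv (k - 1)))
      = real (mult (coeff A (nv k))) + nslope p A k * (real i - real (nv k))"
    using sl by (simp add: algebra_simps)
  show "real (mult (coeff A (nv k))) + nslope p A k * (real i - real (nv k)) \<le> real (mult (coeff A i))"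
    by (rule edge_above[OF v lt nv_adjacent[OF k] sl i])
  then show "real (mult (coeff A (nv (k - 1)))) + nslope p A k * (real i - real (nv (k - 1))) \<le> real (mult (coeff A i))"
    unfolding eq .
  assume "i < nv (k - 1) \<or> nv k < i"
  then show "real (mult (coeff A (nv k))) + nslope p A k * (real i - real (nv k)) < real (mult (coeff A i))"
    by (rule edge_above_outside[OF v lt sl i])
  then show "real (mult (coeff A (nv (k - 1)))) + nslope p A k * (real i - real (nv (k - 1))) < real (mult (coeff A i))"
    unfolding eq .
qed

section \<open>The block triangular basis\<close>

text \<open>Both normalised families \<open>X\<close> and \<open>Y\<close> are built for all rows,
  since the determinant of either one is found from the pair; only afterwards does the sign of the
  slope select the rows of \<open>Q\<close>.\<close>

lemma block_rows:
  obtains Q where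
    "\<And>i. i \<in> {1..degree A} \<Longrightarrow> recur (Q i)"
    "\<And>k i j. k \<in> {1..nr p A} \<Longrightarrow> nv (k - 1) < i \<Longrightarrow> i \<le> nv k \<Longrightarrow>
      j \<le> nv (k - 1) \<or> nv k + N < j \<Longrightarrow> Q i j = 0"
    "\<And>k i j. k \<in> {1..nr p A} \<Longrightarrow> k < ns p A \<Longrightarrow> nv (k - 1) < i \<Longrightarrow> i \<le> nv k \<Longrightarrow>
      nv (k - 1) < j \<Longrightarrow> j \<le> nv k \<Longrightarrow> Q i j = (if i = j then 1 else 0)"
    "\<And>k i j. k \<in> {1..nr p A} \<Longrightarrow> ns p A \<le> k \<Longrightarrow> nv (k - 1) < i \<Longrightarrow> i \<le> nv k \<Longrightarrow>
      nv (k - 1) < j \<Longrightarrow> j \<le> nv k \<Longrightarrow> Q i (N + j) = (if i = j then 1 else 0)"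
    "\<And>k i j. k \<in> {1..nr p A} \<Longrightarrow> k < ns p A \<Longrightarrow> nv (k - 1) < i \<Longrightarrow> i \<le> nv k \<Longrightarrow>
      j \<in> {1..m} \<Longrightarrow> vge (Q i j) (- nslope p A k * (real j - real i))"
    "\<And>k i j. k \<in> {1..nr p A} \<Longrightarrow> ns p A \<le> k \<Longrightarrow> nv (k - 1) < i \<Longrightarrow> i \<le> nv k \<Longrightarrow>
      j \<in> {1..m} \<Longrightarrow> vge (Q i j) (- nslope p A k * (real j - real (N + i)))"
    "\<And>k. k \<in> {1..nr p A} \<Longrightarrow> k < ns p A \<Longrightarrow>
      det (mat (nlen p A k) (nlen p A k) (\<lambda>(i,j). Q (nv (k - 1) + 1 + i) (N + nv (k - 1) + 1 + j))) \<noteq> 0 \<and>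
      real_of_int (val (det (mat (nlen p A k) (nlen p A k) (\<lambda>(i,j). Q (nv (k - 1) + 1 + i) (N + nv (k - 1) + 1 + j)))))
        = - nslope p A k * real (nlen p A k) * real N"
    "\<And>k. k \<in> {1..nr p A} \<Longrightarrow> ns p A \<le> k \<Longrightarrow>
      det (mat (nlen p A k) (nlen p A k) (\<lambda>(i,j). Q (nv (k - 1) + 1 + i) (nv (k - 1) + 1 + j))) \<noteq> 0 \<and>
      real_of_int (val (det (mat (nlen p A k) (nlen p A k) (\<lambda>(i,j). Q (nv (k - 1) + 1 + i) (nv (k - 1) + 1 + j)))))
        = nslope p A k * real (nlen p A k) * real N"
proof -
  have "\<forall>i\<in>{1..degree A}. \<exists>X. recur X \<and>
      (\<forall>j. outside (nv (blk i)) j \<longrightarrow> X j = (if j = i then 1 else 0)) \<and>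
      (\<forall>j\<in>{1..m}. vge (X j) (- nslope p A (blk i) * (real j - real i)))"
  proof
    fix i assume i: "i \<in> {1..degree A}"
    note b = blk[OF i]
    have "nv (blk i) \<in> newton_vertices p A" using b(1) by (intro nv_vertex) auto
    then show "\<exists>X. recur X \<and>
      (\<forall>j. outside (nv (blk i)) j \<longrightarrow> X j = (if j = i then 1 else 0)) \<and>
      (\<forall>j\<in>{1..m}. vge (X j) (- nslope p A (blk i) * (real j - real i)))"
      by (rule left_block_row[OF _ b(2,3) edge_bounds(1,2)[OF b(1)]]) auto
  qed
  from bchoice[OF this] obtain X where X: "\<And>i. i \<in> {1..degree A} \<Longrightarrow> recur (X i) \<and>
      (\<forall>j. outside (nv (blk i)) j \<longrightarrow> X i j = (if j = i then 1 else 0)) \<and>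
      (\<forall>j\<in>{1..m}. vge (X i j) (- nslope p A (blk i) * (real j - real i)))"
    by blast
  have "\<forall>i\<in>{1..degree A}. \<exists>Y. recur Y \<and>
      (\<forall>j. outside (nv (blk i - 1)) j \<longrightarrow> Y j = (if j = N + i then 1 else 0)) \<and>
      (\<forall>j\<in>{1..m}. vge (Y j) (- nslope p A (blk i) * (real j - real (N + i))))"
  proof
    fix i assume i: "i \<in> {1..degree A}"
    note b = blk[OF i]
    have "nv (blk i - 1) \<in> newton_vertices p A" using b(1) by (intro nv_vertex) auto
    then show "\<exists>Y. recur Y \<and>
      (\<forall>j. outside (nv (blk i - 1)) j \<longrightarrow> Y j = (if j = N + i then 1 else 0)) \<and>
      (\<forall>j\<in>{1..m}. vge (Y j) (- nslope p A (blk i) * (real j - real (N + i))))"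
      by (rule right_block_row[OF _ b(2) edge_bounds(3,4)[OF b(1)]]) auto
  qed
  from bchoice[OF this] obtain Y where Y: "\<And>i. i \<in> {1..degree A} \<Longrightarrow> recur (Y i) \<and>
      (\<forall>j. outside (nv (blk i - 1)) j \<longrightarrow> Y i j = (if j = N + i then 1 else 0)) \<and>
      (\<forall>j\<in>{1..m}. vge (Y i j) (- nslope p A (blk i) * (real j - real (N + i))))"
    by blast
  define Q where "Q = (\<lambda>i. if blk i < ns p A then X i else Y i)"
  have XB: "recur (X i)" "outside (nv k) j \<Longrightarrow> X i j = (if j = i then 1 else 0)"
      "j \<in> {1..m} \<Longrightarrow> vge (X i j) (- nslope p A k * (real j - real i))"
    and YB: "recur (Y i)" "outside (nv (k - 1)) j \<Longrightarrow> Y i j = (if j = N + i then 1 else 0)"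
      "j \<in> {1..m} \<Longrightarrow> vge (Y i j) (- nslope p A k * (real j - real (N + i)))"
    and QX: "k < ns p A \<Longrightarrow> Q i = X i" and QY: "ns p A \<le> k \<Longrightarrow> Q i = Y i"
    if "k \<in> {1..nr p A}" "nv (k - 1) < i" "i \<le> nv k" for k i j
    using X[OF blk_eqI(1)[OF that]] Y[OF blk_eqI(1)[OF that]] unfolding blk_eqI(2)[OF that] Q_def
    by (blast, blast, blast, blast, blast, blast, simp_all add: blk_eqI(2)[OF that])
  have dets:
    "det (mat (nlen p A k) (nlen p A k) (\<lambda>(i,j). X (nv (k - 1) + 1 + i) (N + nv (k - 1) + 1 + j))) \<noteq> 0"
    "real_of_int (val (det (mat (nlen p A k) (nlen p A k) (\<lambda>(i,j). X (nv (k - 1) + 1 + i) (N + nv (k - 1) + 1 + j)))))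
      = - nslope p A k * real (nlen p A k) * real N"
    "det (mat (nlen p A k) (nlen p A k) (\<lambda>(i,j). Y (nv (k - 1) + 1 + i) (nv (k - 1) + 1 + j))) \<noteq> 0"
    "real_of_int (val (det (mat (nlen p A k) (nlen p A k) (\<lambda>(i,j). Y (nv (k - 1) + 1 + i) (nv (k - 1) + 1 + j)))))
      = nslope p A k * real (nlen p A k) * real N"
    if k: "k \<in> {1..nr p A}" for k
  proof -
    have v: "nv (k - 1) \<in> newton_vertices p A" "nv k \<in> newton_vertices p A"
      using k by (auto intro!: nv_vertex)
    note bd = block_dets[OF v nv_step[OF k], where X = X and Y = Y and \<sigma> = "nslope p A k",
        OF XB(1)[OF k] XB(2)[OF k] XB(3)[OF k] YB(1)[OF k] YB(2)[OF k] YB(3)[OF k], folded nlen_def]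
    show "det (mat (nlen p A k) (nlen p A k) (\<lambda>(i,j). X (nv (k - 1) + 1 + i) (N + nv (k - 1) + 1 + j))) \<noteq> 0"
      by (rule bd(1))
    show "real_of_int (val (det (mat (nlen p A k) (nlen p A k) (\<lambda>(i,j). X (nv (k - 1) + 1 + i) (N + nv (k - 1) + 1 + j)))))
      = - nslope p A k * real (nlen p A k) * real N"
      by (rule bd(2))
    show "det (mat (nlen p A k) (nlen p A k) (\<lambda>(i,j). Y (nv (k - 1) + 1 + i) (nv (k - 1) + 1 + j))) \<noteq> 0"
      by (rule bd(3))
    show "real_of_int (val (det (mat (nlen p A k) (nlen p A k) (\<lambda>(i,j). Y (nv (k - 1) + 1 + i) (nv (k - 1) + 1 + j)))))
      = nslope p A k * real (nlen p A k) * real N"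
      by (rule bd(4))
  qed
  have in_blk: "nv (k - 1) < nv (k - 1) + 1 + i" "nv (k - 1) + 1 + i \<le> nv k" if "i < nlen p A k" for i k
    using that by (auto simp: nlen_def)
  show thesis
  proof (rule that)
    fix i assume "i \<in> {1..degree A}"
    then show "recur (Q i)" using X Y by (simp add: Q_def)
  next
    fix k i j assume k: "k \<in> {1..nr p A}" and i: "nv (k - 1) < i" "i \<le> nv k"
      and j: "j \<le> nv (k - 1) \<or> nv k + N < j"
    \<comment> \<open>Such a column lies outside the windows at both ends of the edge and misses
      both possible unit columns, so the entry vanishes under either normalisation.\<close>
    have "outside (nv (k - 1)) j" "outside (nv k) j" "j \<noteq> i" "j \<noteq> N + i" using i j by auto
    then show "Q i j = 0"
      using XB(2)[OF k i, of j] YB(2)[OF k i, of j] QX[OF k i] QY[OF k i]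
      by (cases "k < ns p A") auto
  next
    fix k i j assume k: "k \<in> {1..nr p A}" "k < ns p A" and i: "nv (k - 1) < i" "i \<le> nv k"
      and j: "nv (k - 1) < j" "j \<le> nv k"
    show "Q i j = (if i = j then 1 else 0)"
      using XB(2)[OF k(1) i, of j] QX[OF k(1) i k(2)] j by auto
  next
    fix k i j assume k: "k \<in> {1..nr p A}" "ns p A \<le> k" and i: "nv (k - 1) < i" "i \<le> nv k"
      and j: "nv (k - 1) < j" "j \<le> nv k"
    show "Q i (N + j) = (if i = j then 1 else 0)"
      using YB(2)[OF k(1) i, of "N + j"] QY[OF k(1) i k(2)] j by auto
  next
    fix k i j assume k: "k \<in> {1..nr p A}" "k < ns p A" and i: "nv (k - 1) < i" "i \<le> nv k"
      and j: "j \<in> {1..m}"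
    show "vge (Q i j) (- nslope p A k * (real j - real i))"
      unfolding QX[OF k(1) i k(2)] by (rule XB(3)[OF k(1) i j])
  next
    fix k i j assume k: "k \<in> {1..nr p A}" "ns p A \<le> k" and i: "nv (k - 1) < i" "i \<le> nv k"
      and j: "j \<in> {1..m}"
    show "vge (Q i j) (- nslope p A k * (real j - real (N + i)))"
      unfolding QY[OF k(1) i k(2)] by (rule YB(3)[OF k(1) i j])
  next
    fix k assume k: "k \<in> {1..nr p A}" "k < ns p A"
    have eq: "mat (nlen p A k) (nlen p A k) (\<lambda>(i,j). Q (nv (k - 1) + 1 + i) (N + nv (k - 1) + 1 + j))
        = mat (nlen p A k) (nlen p A k) (\<lambda>(i,j). X (nv (k - 1) + 1 + i) (N + nv (k - 1) + 1 + j))"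
      by (intro cong_mat refl) (simp only: split QX[OF k(1) in_blk k(2)])
    show "det (mat (nlen p A k) (nlen p A k) (\<lambda>(i,j). Q (nv (k - 1) + 1 + i) (N + nv (k - 1) + 1 + j))) \<noteq> 0 \<and>
      real_of_int (val (det (mat (nlen p A k) (nlen p A k) (\<lambda>(i,j). Q (nv (k - 1) + 1 + i) (N + nv (k - 1) + 1 + j)))))
        = - nslope p A k * real (nlen p A k) * real N"
      unfolding eq using dets(1,2)[OF k(1)] by (rule conjI)
  next
    fix k assume k: "k \<in> {1..nr p A}" "ns p A \<le> k"
    have eq: "mat (nlen p A k) (nlen p A k) (\<lambda>(i,j). Q (nv (k - 1) + 1 + i) (nv (k - 1) + 1 + j))
        = mat (nlen p A k) (nlen p A k) (\<lambda>(i,j). Y (nv (k - 1) + 1 + i) (nv (k - 1) + 1 + j))"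
      by (intro cong_mat refl) (simp only: split QY[OF k(1) in_blk k(2)])
    show "det (mat (nlen p A k) (nlen p A k) (\<lambda>(i,j). Q (nv (k - 1) + 1 + i) (nv (k - 1) + 1 + j))) \<noteq> 0 \<and>
      real_of_int (val (det (mat (nlen p A k) (nlen p A k) (\<lambda>(i,j). Q (nv (k - 1) + 1 + i) (nv (k - 1) + 1 + j)))))
        = nslope p A k * real (nlen p A k) * real N"
      unfolding eq using dets(3,4)[OF k(1)] by (rule conjI)
  qed
qed

text \<open>The prescribed zeros and the identity block together fill exactly the columns outside
  one window: at \<open>nv k\<close> for a left-normalised row, at \<open>nv (k - 1)\<close> for a
  right-normalised one. A p-adic recurrence is determined by these columns.\<close>

lemma block_rows_unique:
  fixes M M' :: "nat \<Rightarrow> nat \<Rightarrow> nat \<Rightarrow> int"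
  assumes basis: "is_Zp_basis p A m M" "is_Zp_basis p A m M'"
    and supp: "\<And>k i j. k \<in> {1..nr p A} \<Longrightarrow> nv (k - 1) < i \<Longrightarrow> i \<le> nv k \<Longrightarrow> j \<in> {1..m} \<Longrightarrow>
        j \<le> nv (k - 1) \<or> nv k + N < j \<Longrightarrow> M i j = M' i j"
    and left: "\<And>k i j. k \<in> {1..nr p A} \<Longrightarrow> k < ns p A \<Longrightarrow> nv (k - 1) < i \<Longrightarrow> i \<le> nv k \<Longrightarrow>
        nv (k - 1) < j \<Longrightarrow> j \<le> nv k \<Longrightarrow> M i j = M' i j"
    and right: "\<And>k i j. k \<in> {1..nr p A} \<Longrightarrow> ns p A \<le> k \<Longrightarrow> nv (k - 1) < i \<Longrightarrow> i \<le> nv k \<Longrightarrow>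
        nv (k - 1) < j \<Longrightarrow> j \<le> nv k \<Longrightarrow> M i (N + j) = M' i (N + j)"
    and i: "i \<in> {1..degree A}" and j: "j \<in> {1..m}"
  shows "M' i j = M i j"
proof -
  note b = blk[OF i]
  let ?k = "blk i"
  define z where "z = (if ?k < ns p A then nv ?k else nv (?k - 1))"
  have z: "z \<in> newton_vertices p A" unfolding z_def using b(1) by (auto intro!: nv_vertex)
  have rv: "rec_vec p A m (M' i)" "rec_vec p A m (M i)"
    using basis[unfolded is_Zp_basis_def, THEN conjunct1] i by blast+
  show ?thesis
  proof (rule padic_window_unique[OF z rv _ j])
    fix j assume j: "j \<in> {1..m}" "outside z j"
    show "M' i j = M i j"
    proof (cases "j \<le> nv (?k - 1) \<or> nv ?k + N < j")
      case True
      then show ?thesis using supp[OF b j(1)] by simp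
    next
      case False
      show ?thesis
      proof (cases "?k < ns p A")
        case True
        then show ?thesis using left[OF b(1) True b(2,3), of j] False j(2) by (auto simp: z_def)
      next
        case right_block: False
        with False j(2) have "nv (?k - 1) < j - N" "j - N \<le> nv ?k" "N + (j - N) = j"
          by (auto simp: z_def)
        with right[OF b(1) _ b(2,3), of "j - N"] right_block show ?thesis by simp
      qed
    qed
  qed
qed

end

section \<open>Assembly: integrality, basis property, valuations and uniqueness\<close>

theorem theorem3:
  fixes A :: "int poly" and m p :: nat
  assumes prim: "content A = 1" and deg: "degree A \<ge> 1" and a0: "coeff A 0 \<noteq> 0"
    and md: "m > degree A" and pp: "prime p"
  defines "d \<equiv> degree A"
  shows "\<exists>M. (is_Zp_basis p A m M \<and>
           (\<forall>k\<in>{1..nr p A}. \<forall>i. nw p A ! (k - 1) < i \<and> i \<le> nw p A ! k \<longrightarrow>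
              (\<forall>j\<in>{1..m}. j \<le> nw p A ! (k - 1) \<or> j > m - d + nw p A ! k \<longrightarrow> M i j = pzero)) \<and>
           (\<forall>k\<in>{1..nr p A}. k < ns p A \<longrightarrow>
              (\<forall>i j. nw p A ! (k - 1) < i \<and> i \<le> nw p A ! k \<and> nw p A ! (k - 1) < j \<and> j \<le> nw p A ! k \<longrightarrow>
                  M i j = (if i = j then pone p else pzero)) \<and>
              pval p (pdet p (nlen p A k) (\<lambda>i j. M (nw p A ! (k - 1) + 1 + i) (m - d + nw p A ! (k - 1) + 1 + j)))
                = ereal (- nslope p A k * real (nlen p A k) * real (m - d))) \<and>
           (\<forall>k\<in>{1..nr p A}. ns p A \<le> k \<longrightarrow>
              (\<forall>i j. nw p A ! (k - 1) < i \<and> i \<le> nw p A ! k \<and> nw p A ! (k - 1) < j \<and> j \<le> nw p A ! k \<longrightarrow>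
                  M i (m - d + j) = (if i = j then pone p else pzero)) \<and>
              pval p (pdet p (nlen p A k) (\<lambda>i j. M (nw p A ! (k - 1) + 1 + i) (nw p A ! (k - 1) + 1 + j)))
                = ereal (nslope p A k * real (nlen p A k) * real (m - d))) \<and>
           (\<forall>k\<in>{1..nr p A}. k < ns p A \<longrightarrow> (\<forall>j t. nw p A ! (k - 1) < j \<and> j \<le> nw p A ! k \<and> j + t \<le> m \<longrightarrow>
              pval p (M j (j + t)) \<ge> ereal (- real t * nslope p A k))) \<and>
           (\<forall>k\<in>{1..nr p A}. ns p A \<le> k \<longrightarrow> (\<forall>j t. nw p A ! (k - 1) < j \<and> j \<le> nw p A ! k \<and> t < j + m - d \<longrightarrow>
              pval p (M j (j + m - d - t)) \<ge> ereal (real t * nslope p A k))))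
         \<and> (\<forall>M'. (is_Zp_basis p A m M' \<and>
           (\<forall>k\<in>{1..nr p A}. \<forall>i. nw p A ! (k - 1) < i \<and> i \<le> nw p A ! k \<longrightarrow>
              (\<forall>j\<in>{1..m}. j \<le> nw p A ! (k - 1) \<or> j > m - d + nw p A ! k \<longrightarrow> M' i j = pzero)) \<and>
           (\<forall>k\<in>{1..nr p A}. k < ns p A \<longrightarrow>
              (\<forall>i j. nw p A ! (k - 1) < i \<and> i \<le> nw p A ! k \<and> nw p A ! (k - 1) < j \<and> j \<le> nw p A ! k \<longrightarrow>
                  M' i j = (if i = j then pone p else pzero)) \<and>
              pval p (pdet p (nlen p A k) (\<lambda>i j. M' (nw p A ! (k - 1) + 1 + i) (m - d + nw p A ! (k - 1) + 1 + j)))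
                = ereal (- nslope p A k * real (nlen p A k) * real (m - d))) \<and>
           (\<forall>k\<in>{1..nr p A}. ns p A \<le> k \<longrightarrow>
              (\<forall>i j. nw p A ! (k - 1) < i \<and> i \<le> nw p A ! k \<and> nw p A ! (k - 1) < j \<and> j \<le> nw p A ! k \<longrightarrow>
                  M' i (m - d + j) = (if i = j then pone p else pzero)) \<and>
              pval p (pdet p (nlen p A k) (\<lambda>i j. M' (nw p A ! (k - 1) + 1 + i) (nw p A ! (k - 1) + 1 + j)))
                = ereal (nslope p A k * real (nlen p A k) * real (m - d))) \<and>
           (\<forall>k\<in>{1..nr p A}. k < ns p A \<longrightarrow> (\<forall>j t. nw p A ! (k - 1) < j \<and> j \<le> nw p A ! k \<and> j + t \<le> m \<longrightarrow>
              pval p (M' j (j + t)) \<ge> ereal (- real t * nslope p A k))) \<and>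
           (\<forall>k\<in>{1..nr p A}. ns p A \<le> k \<longrightarrow> (\<forall>j t. nw p A ! (k - 1) < j \<and> j \<le> nw p A ! k \<and> t < j + m - d \<longrightarrow>
              pval p (M' j (j + m - d - t)) \<ge> ereal (real t * nslope p A k))))
           \<longrightarrow> (\<forall>i\<in>{1..d}. \<forall>j\<in>{1..m}. M' i j = M i j))"
proof -
  interpret recurrence p A m
    using pp deg a0 md by unfold_locales
  show ?thesis
  proof (rule block_rows, goal_cases)
    case (1 Q)
    note rec = 1(1) and supp = 1(2) and left = 1(3) and right = 1(4)
      and lbound = 1(5) and rbound = 1(6) and ldet = 1(7) and rdet = 1(8)
    let ?M = "\<lambda>i j. emb (Q i j)"
    have dN: "d + N = m" using md by (simp add: d_def)
    have nv_le: "nw p A ! k \<le> d" if "k \<le> nr p A" for k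
      using vertex_bounds(1)[OF nv_vertex[OF that]] by (simp add: d_def)
    \<comment> \<open>Here the sign of the slope enters. Under left normalisation the valuation
      bound is nonnegative from the unit entry rightwards, and everything to its left is in the
      identity block or a prescribed zero. Under right normalisation the roles of the sides are
      exchanged.\<close>
    have int_blk: "vge (Q i j) 0"
      if k: "k \<in> {1..nr p A}" and i: "nw p A ! (k - 1) < i" "i \<le> nw p A ! k" and j: "j \<in> {1..m}" for k i j
    proof (cases "j \<le> nw p A ! (k - 1) \<or> nw p A ! k + N < j")
      case True
      then show ?thesis using supp[OF k i] by simp
    next
      case False
      show ?thesis
      proof (cases "k < ns p A")
        case True
        show ?thesis
        proof (cases "j \<ge> i")
          case ji: True
          then have "0 \<le> - nslope p A k * (real j - real i)"
            using nslope_before[OF k True] by (intro mult_nonneg_nonneg) auto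
          with lbound[OF k True i j] show ?thesis by (rule vge_mono)
        next
          case False
          with left[OF k True i, of j] i \<open>\<not> (j \<le> _ \<or> _)\<close> show ?thesis by auto
        qed
      next
        case right_block: False
        then have ns: "ns p A \<le> k" by simp
        show ?thesis
        proof (cases "j \<le> N + i")
          case True
          then have "0 \<le> nslope p A k * (real (N + i) - real j)"
            using nslope_after[OF k ns] by (intro mult_nonneg_nonneg) auto
          then have "0 \<le> - nslope p A k * (real j - real (N + i))" by (simp add: algebra_simps)
          with rbound[OF k ns i j] show ?thesis by (rule vge_mono)
        next
          case ji: False
          with False i have "nw p A ! (k - 1) < j - N" "j - N \<le> nw p A ! k" "N + (j - N) = j" by auto
          with right[OF k ns i, of "j - N"] ji show ?thesis by auto
        qed
      qed
    qed
    have int: "vge (Q i j) 0" if "i \<in> {1..degree A}" "j \<in> {1..m}" for i j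
      using int_blk[OF blk[OF that(1)] that(2)] .

    \<comment> \<open>The vertex where the slopes turn nonnegative, 0 if all are and
      \<open>d\<close> if none is. Rows up to \<open>h\<close> are left-normalised, the others
      right-normalised, so all unit entries lie outside the single window at
      \<open>h\<close>.\<close>
    define h where "h = nw p A ! (ns p A - 1)"
    have hv: "h \<in> newton_vertices p A"
      unfolding h_def using ns_range by (intro nv_vertex) auto
    have blk_h: "blk i < ns p A \<longleftrightarrow> i \<le> h" if i: "i \<in> {1..degree A}" for i
    proof
      assume "blk i < ns p A"
      then have "nw p A ! blk i \<le> h"
        unfolding h_def using ns_range blk(1)[OF i] by (subst nv_le_iff) auto
      with blk(3)[OF i] show "i \<le> h" by simp
    next
      assume ih: "i \<le> h"
      show "blk i < ns p A"
      proof (rule ccontr)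
        assume "\<not> blk i < ns p A"
        then have "h \<le> nw p A ! (blk i - 1)"
          unfolding h_def using ns_range blk(1)[OF i] by (subst nv_le_iff) auto
        with blk(2)[OF i] ih show False by simp
      qed
    qed
    have basis: "is_Zp_basis p A m ?M"
    \<comment> \<open>A left-normalised row meets, besides its unit, only unit columns of later
      blocks up to \<open>h\<close>; a right-normalised row only those of earlier blocks beyond
      \<open>h\<close>. Hence the rank decreases with the index up to \<open>h\<close> and increases
      after it.\<close>
    proof (rule basis_of_unitriangular[where h = h and rk = "\<lambda>i. if i \<le> h then h - i else i"])
      fix i assume i: "i \<in> {1..degree A}"
      note b = blk[OF i]
      show "Q i (if i \<le> h then i else N + i) = 1"
        using left[OF b(1) _ b(2,3) b(2,3)] right[OF b(1) _ b(2,3) b(2,3)] blk_h[OF i] by auto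
      fix i' assume i': "i' \<in> {1..degree A}" "i' \<noteq> i"
        and nz: "Q i (if i' \<le> h then i' else N + i') \<noteq> 0"
      show "(if i' \<le> h then h - i' else i') < (if i \<le> h then h - i else i)"
      proof (cases "i \<le> h")
        case True
        then have ns: "blk i < ns p A" using blk_h[OF i] by simp
        have "nw p A ! blk i \<le> h"
          unfolding h_def using ns_range b(1) ns by (subst nv_le_iff) auto
        then have i'h: "i' \<le> h"
          using nz supp[OF b, of "N + i'"] by (auto split: if_splits)
        then have "\<not> i' \<le> nw p A ! blk i"
          using nz supp[OF b, of i'] left[OF b(1) ns b(2,3), of i'] i'(2)
          by (cases "i' \<le> nw p A ! (blk i - 1)") auto
        with b(3) i'h True show ?thesis by auto
      next
        case False
        then have ns: "ns p A \<le> blk i" using blk_h[OF i] by simp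
        have "h \<le> nw p A ! (blk i - 1)"
          unfolding h_def using ns_range b(1) ns by (subst nv_le_iff) auto
        then have i'h: "\<not> i' \<le> h"
          using nz supp[OF b, of i'] by (auto split: if_splits)
        then have "i' \<le> nw p A ! (blk i - 1)"
          using nz supp[OF b, of "N + i'"] right[OF b(1) ns b(2,3), of i'] i'(2)
          by (intro leI notI, cases "nw p A ! blk i < i'") auto
        with b(2) i'h False show ?thesis by auto
      qed
    qed (use hv rec int in auto)

    have c1: "(\<forall>k\<in>{1..nr p A}. \<forall>i. nw p A ! (k - 1) < i \<and> i \<le> nw p A ! k \<longrightarrow>
              (\<forall>j\<in>{1..m}. j \<le> nw p A ! (k - 1) \<or> j > m - d + nw p A ! k \<longrightarrow> ?M i j = pzero))"
    proof (intro ballI allI impI)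
      fix k i j assume k: "k \<in> {1..nr p A}" and i: "nw p A ! (k - 1) < i \<and> i \<le> nw p A ! k"
        and j: "j \<le> nw p A ! (k - 1) \<or> j > m - d + nw p A ! k"
      then have "Q i j = 0" by (intro supp[OF k]) (auto simp: d_def)
      then show "?M i j = pzero" by (simp only: emb_zero)
    qed

    have c2: "(\<forall>k\<in>{1..nr p A}. k < ns p A \<longrightarrow>
              (\<forall>i j. nw p A ! (k - 1) < i \<and> i \<le> nw p A ! k \<and> nw p A ! (k - 1) < j \<and> j \<le> nw p A ! k \<longrightarrow>
                  ?M i j = (if i = j then pone p else pzero)) \<and>
              pval p (pdet p (nlen p A k) (\<lambda>i j. ?M (nw p A ! (k - 1) + 1 + i) (m - d + nw p A ! (k - 1) + 1 + j)))
                = ereal (- nslope p A k * real (nlen p A k) * real (m - d)))"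
    proof (intro ballI impI conjI)
      fix k assume k: "k \<in> {1..nr p A}" "k < ns p A"
      show "\<forall>i j. nw p A ! (k - 1) < i \<and> i \<le> nw p A ! k \<and> nw p A ! (k - 1) < j \<and> j \<le> nw p A ! k \<longrightarrow>
                  ?M i j = (if i = j then pone p else pzero)"
        using left[OF k] by (auto simp: emb_zero emb_one)
      let ?C = "mat (nlen p A k) (nlen p A k) (\<lambda>(i,j). Q (nw p A ! (k - 1) + 1 + i) (N + nw p A ! (k - 1) + 1 + j))"
      have "pdet p (nlen p A k) (\<lambda>i j. ?M (nw p A ! (k - 1) + 1 + i) (N + nw p A ! (k - 1) + 1 + j)) = emb (det ?C)"
      proof (rule pdet_emb)
        fix i j assume "i < nlen p A k" "j < nlen p A k"
        then show "vge (Q (nw p A ! (k - 1) + 1 + i) (N + nw p A ! (k - 1) + 1 + j)) 0"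
          using nv_le[of k] k(1) dN by (intro int_blk[OF k(1)]) (auto simp: nlen_def)
      qed
      moreover have "0 \<le> - nslope p A k * real (nlen p A k) * real N"
        using nslope_before[OF k] by (intro mult_nonneg_nonneg) auto
      then have "0 \<le> val (det ?C)" using ldet[OF k] by linarith
      ultimately show "pval p (pdet p (nlen p A k) (\<lambda>i j. ?M (nw p A ! (k - 1) + 1 + i) (m - d + nw p A ! (k - 1) + 1 + j)))
                = ereal (- nslope p A k * real (nlen p A k) * real (m - d))"
        using pval_emb[of "det ?C"] ldet[OF k] by (simp add: d_def)
    qed

    have c3: "(\<forall>k\<in>{1..nr p A}. ns p A \<le> k \<longrightarrow>
              (\<forall>i j. nw p A ! (k - 1) < i \<and> i \<le> nw p A ! k \<and> nw p A ! (k - 1) < j \<and> j \<le> nw p A ! k \<longrightarrow>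
                  ?M i (m - d + j) = (if i = j then pone p else pzero)) \<and>
              pval p (pdet p (nlen p A k) (\<lambda>i j. ?M (nw p A ! (k - 1) + 1 + i) (nw p A ! (k - 1) + 1 + j)))
                = ereal (nslope p A k * real (nlen p A k) * real (m - d)))"
    proof (intro ballI impI conjI)
      fix k assume k: "k \<in> {1..nr p A}" "ns p A \<le> k"
      show "\<forall>i j. nw p A ! (k - 1) < i \<and> i \<le> nw p A ! k \<and> nw p A ! (k - 1) < j \<and> j \<le> nw p A ! k \<longrightarrow>
                  ?M i (m - d + j) = (if i = j then pone p else pzero)"
        using right[OF k] by (auto simp: emb_zero emb_one d_def)
      let ?B = "mat (nlen p A k) (nlen p A k) (\<lambda>(i,j). Q (nw p A ! (k - 1) + 1 + i) (nw p A ! (k - 1) + 1 + j))"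
      have "pdet p (nlen p A k) (\<lambda>i j. ?M (nw p A ! (k - 1) + 1 + i) (nw p A ! (k - 1) + 1 + j)) = emb (det ?B)"
      proof (rule pdet_emb)
        fix i j assume "i < nlen p A k" "j < nlen p A k"
        then show "vge (Q (nw p A ! (k - 1) + 1 + i) (nw p A ! (k - 1) + 1 + j)) 0"
          using nv_le[of k] k(1) dN by (intro int_blk[OF k(1)]) (auto simp: nlen_def)
      qed
      moreover have "0 \<le> nslope p A k * real (nlen p A k) * real N"
        using nslope_after[OF k] by (intro mult_nonneg_nonneg) auto
      then have "0 \<le> val (det ?B)" using rdet[OF k] by linarith
      ultimately show "pval p (pdet p (nlen p A k) (\<lambda>i j. ?M (nw p A ! (k - 1) + 1 + i) (nw p A ! (k - 1) + 1 + j)))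
                = ereal (nslope p A k * real (nlen p A k) * real (m - d))"
        using pval_emb[of "det ?B"] rdet[OF k] by (simp add: d_def)
    qed

    have c4: "(\<forall>k\<in>{1..nr p A}. k < ns p A \<longrightarrow> (\<forall>j t. nw p A ! (k - 1) < j \<and> j \<le> nw p A ! k \<and> j + t \<le> m \<longrightarrow>
              pval p (?M j (j + t)) \<ge> ereal (- real t * nslope p A k)))"
    proof (intro ballI impI allI)
      fix k j t assume k: "k \<in> {1..nr p A}" "k < ns p A"
        and j: "nw p A ! (k - 1) < j \<and> j \<le> nw p A ! k \<and> j + t \<le> m"
      then have jt: "j + t \<in> {1..m}" by auto
      have "vge (Q j (j + t)) (- real t * nslope p A k)"
        using lbound[OF k _ _ jt, of j] j by (simp add: mult.commute)
      with int_blk[OF k(1) _ _ jt, of j] j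
      show "ereal (- real t * nslope p A k) \<le> pval p (?M j (j + t))"
        by (intro pval_emb_ge) auto
    qed

    have c5: "(\<forall>k\<in>{1..nr p A}. ns p A \<le> k \<longrightarrow> (\<forall>j t. nw p A ! (k - 1) < j \<and> j \<le> nw p A ! k \<and> t < j + m - d \<longrightarrow>
              pval p (?M j (j + m - d - t)) \<ge> ereal (real t * nslope p A k)))"
    proof (intro ballI impI allI)
      fix k j t assume k: "k \<in> {1..nr p A}" "ns p A \<le> k"
        and j: "nw p A ! (k - 1) < j \<and> j \<le> nw p A ! k \<and> t < j + m - d"
      have jt: "j + m - d - t \<in> {1..m}" using j nv_le[of k] k(1) by auto
      \<comment> \<open>The bound on \<open>t\<close> keeps the truncated subtraction exact, so the
        distance to the unit column is precisely \<open>t\<close>.\<close>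
      have "j + m - d - t + t = N + j" using j dN by linarith
      then have "real (j + m - d - t) - real (N + j) = - real t"
        unfolding of_nat_eq_iff [where 'a = real, symmetric] by simp
      then have "vge (Q j (j + m - d - t)) (real t * nslope p A k)"
        using rbound[OF k _ _ jt, of j] j by (simp add: mult.commute)
      with int_blk[OF k(1) _ _ jt, of j] j
      show "ereal (real t * nslope p A k) \<le> pval p (?M j (j + m - d - t))"
        by (intro pval_emb_ge) auto
    qed

    show ?case
    proof (intro exI[of _ ?M] conjI)
      show "\<forall>M'. (is_Zp_basis p A m M' \<and>
           (\<forall>k\<in>{1..nr p A}. \<forall>i. nw p A ! (k - 1) < i \<and> i \<le> nw p A ! k \<longrightarrow>
              (\<forall>j\<in>{1..m}. j \<le> nw p A ! (k - 1) \<or> j > m - d + nw p A ! k \<longrightarrow> M' i j = pzero)) \<and>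
           (\<forall>k\<in>{1..nr p A}. k < ns p A \<longrightarrow>
              (\<forall>i j. nw p A ! (k - 1) < i \<and> i \<le> nw p A ! k \<and> nw p A ! (k - 1) < j \<and> j \<le> nw p A ! k \<longrightarrow>
                  M' i j = (if i = j then pone p else pzero)) \<and>
              pval p (pdet p (nlen p A k) (\<lambda>i j. M' (nw p A ! (k - 1) + 1 + i) (m - d + nw p A ! (k - 1) + 1 + j)))
                = ereal (- nslope p A k * real (nlen p A k) * real (m - d))) \<and>
           (\<forall>k\<in>{1..nr p A}. ns p A \<le> k \<longrightarrow>
              (\<forall>i j. nw p A ! (k - 1) < i \<and> i \<le> nw p A ! k \<and> nw p A ! (k - 1) < j \<and> j \<le> nw p A ! k \<longrightarrow>
                  M' i (m - d + j) = (if i = j then pone p else pzero)) \<and>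
              pval p (pdet p (nlen p A k) (\<lambda>i j. M' (nw p A ! (k - 1) + 1 + i) (nw p A ! (k - 1) + 1 + j)))
                = ereal (nslope p A k * real (nlen p A k) * real (m - d))) \<and>
           (\<forall>k\<in>{1..nr p A}. k < ns p A \<longrightarrow> (\<forall>j t. nw p A ! (k - 1) < j \<and> j \<le> nw p A ! k \<and> j + t \<le> m \<longrightarrow>
              pval p (M' j (j + t)) \<ge> ereal (- real t * nslope p A k))) \<and>
           (\<forall>k\<in>{1..nr p A}. ns p A \<le> k \<longrightarrow> (\<forall>j t. nw p A ! (k - 1) < j \<and> j \<le> nw p A ! k \<and> t < j + m - d \<longrightarrow>
              pval p (M' j (j + m - d - t)) \<ge> ereal (real t * nslope p A k))))
           \<longrightarrow> (\<forall>i\<in>{1..d}. \<forall>j\<in>{1..m}. M' i j = ?M i j)"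
      proof (intro allI impI ballI)
        fix M' i j assume H: "is_Zp_basis p A m M' \<and>
           (\<forall>k\<in>{1..nr p A}. \<forall>i. nw p A ! (k - 1) < i \<and> i \<le> nw p A ! k \<longrightarrow>
              (\<forall>j\<in>{1..m}. j \<le> nw p A ! (k - 1) \<or> j > m - d + nw p A ! k \<longrightarrow> M' i j = pzero)) \<and>
           (\<forall>k\<in>{1..nr p A}. k < ns p A \<longrightarrow>
              (\<forall>i j. nw p A ! (k - 1) < i \<and> i \<le> nw p A ! k \<and> nw p A ! (k - 1) < j \<and> j \<le> nw p A ! k \<longrightarrow>
                  M' i j = (if i = j then pone p else pzero)) \<and>
              pval p (pdet p (nlen p A k) (\<lambda>i j. M' (nw p A ! (k - 1) + 1 + i) (m - d + nw p A ! (k - 1) + 1 + j)))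
                = ereal (- nslope p A k * real (nlen p A k) * real (m - d))) \<and>
           (\<forall>k\<in>{1..nr p A}. ns p A \<le> k \<longrightarrow>
              (\<forall>i j. nw p A ! (k - 1) < i \<and> i \<le> nw p A ! k \<and> nw p A ! (k - 1) < j \<and> j \<le> nw p A ! k \<longrightarrow>
                  M' i (m - d + j) = (if i = j then pone p else pzero)) \<and>
              pval p (pdet p (nlen p A k) (\<lambda>i j. M' (nw p A ! (k - 1) + 1 + i) (nw p A ! (k - 1) + 1 + j)))
                = ereal (nslope p A k * real (nlen p A k) * real (m - d))) \<and>
           (\<forall>k\<in>{1..nr p A}. k < ns p A \<longrightarrow> (\<forall>j t. nw p A ! (k - 1) < j \<and> j \<le> nw p A ! k \<and> j + t \<le> m \<longrightarrow>
              pval p (M' j (j + t)) \<ge> ereal (- real t * nslope p A k))) \<and>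
           (\<forall>k\<in>{1..nr p A}. ns p A \<le> k \<longrightarrow> (\<forall>j t. nw p A ! (k - 1) < j \<and> j \<le> nw p A ! k \<and> t < j + m - d \<longrightarrow>
              pval p (M' j (j + m - d - t)) \<ge> ereal (real t * nslope p A k)))" and i: "i \<in> {1..d}" and j: "j \<in> {1..m}"
        note s = H[THEN conjunct2, THEN conjunct1] and l = H[THEN conjunct2, THEN conjunct2, THEN conjunct1]
          and r = H[THEN conjunct2, THEN conjunct2, THEN conjunct2, THEN conjunct1]
        show "M' i j = ?M i j"
        proof (rule block_rows_unique[OF basis H[THEN conjunct1]])
          fix k i j assume k: "k \<in> {1..nr p A}" and ij: "nw p A ! (k - 1) < i" "i \<le> nw p A ! k" "j \<in> {1..m}"
            "j \<le> nw p A ! (k - 1) \<or> nw p A ! k + N < j"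
          have out: "j \<le> nw p A ! (k - 1) \<or> j > m - d + nw p A ! k" using ij(4) by (auto simp: d_def)
          have "?M i j = pzero" using bspec[OF c1 k] ij(1-3) out by blast
          moreover have "M' i j = pzero" using bspec[OF s k] ij(1-3) out by blast
          ultimately show "?M i j = M' i j" by simp
        next
          fix k i j assume k: "k \<in> {1..nr p A}" "k < ns p A" and ij: "nw p A ! (k - 1) < i" "i \<le> nw p A ! k"
            "nw p A ! (k - 1) < j" "j \<le> nw p A ! k"
          have "?M i j = (if i = j then pone p else pzero)" using bspec[OF c2 k(1)] k(2) ij by blast
          moreover have "M' i j = (if i = j then pone p else pzero)" using bspec[OF l k(1)] k(2) ij by blast
          ultimately show "?M i j = M' i j" by simp
        next
          fix k i j assume k: "k \<in> {1..nr p A}" "ns p A \<le> k" and ij: "nw p A ! (k - 1) < i" "i \<le> nw p A ! k"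
            "nw p A ! (k - 1) < j" "j \<le> nw p A ! k"
          have "?M i (m - d + j) = (if i = j then pone p else pzero)" using bspec[OF c3 k(1)] k(2) ij by blast
          moreover have "M' i (m - d + j) = (if i = j then pone p else pzero)" using bspec[OF r k(1)] k(2) ij by blast
          ultimately show "?M i (N + j) = M' i (N + j)" by (simp add: d_def)
        qed (use i j in \<open>auto simp: d_def\<close>)
      qed
    qed (fact basis c1 c2 c3 c4 c5)+
  qed
qed

end
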